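(* Let $p$ be an odd prime and $\alpha,\beta,\gamma\in\mathbb Z_p$. Suppose that $\max\{\langle-\alpha\rangle_p,\langle-\beta\rangle_p\}\leq\langle-\gamma\rangle_p$ and $(\gamma)_{p-1}$ is not divisible by $p^2$. If $\langle-\alpha\rangle_p+\langle-\beta\rangle_p<\langle-\gamma\rangle_p$, then $$ {}_3F_2\bigg[\begin{matrix}\alpha&\beta&\gamma-\alpha-\beta\\&1&\gamma\end{matrix}\bigg|\,1\bigg]_{p-1}\equiv-\frac{\Gamma_p(1+\alpha-\gamma)\Gamma_p(1+\beta-\gamma)\Gamma_p(1-\alpha-\beta)}{\Gamma_p(1-\alpha)\Gamma_p(1-\beta)\Gamma_p(1-\gamma)\Gamma_p(1+\alpha+\beta-\gamma)}\pmod{p^2}. $$ If $\langle-\alpha\rangle_p+\langle-\beta\rangle_p>p$, then $$ {}_3F_2\bigg[\begin{matrix}\alpha&\beta&\gamma-\alpha-\beta\\&1&\gamma\end{matrix}\bigg|\,1\bigg]_{p-1}\equiv0\pmod{p^2}. $$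
   Context: $\mathbb Z_p$ denotes the $p$-adic integers. For $\alpha\in\mathbb Z_p$, $\langle\alpha\rangle_p$ is the unique integer in $\{0,1,\ldots,p-1\}$ congruent to $\alpha$ modulo $p$. Pochhammer symbol: $(x)_0=1$, $(x)_k=x(x+1)\cdots(x+k-1)$. For $n\ge 0$ the truncated hypergeometric series is ${}_{m+1}F_m\Big[\begin{matrix}\alpha_0&\alpha_1&\ldots&\alpha_m\\&\beta_1&\ldots&\beta_m\end{matrix}\Big|\,z\Big]_n=\sum_{k=0}^{n}\frac{(\alpha_0)_k\cdots(\alpha_m)_k}{(\beta_1)_k\cdots(\beta_m)_k}\cdot\frac{z^k}{k!}$. $\Gamma_p$ is Morita's $p$-adic gamma function: $\Gamma_p(n)=(-1)^n\prod_{1\le j<n,\ p\nmid j}j$ for integers $n\ge1$, $\Gamma_p(0)=1$, extended to $\mathbb Z_p$ by continuity. For $x,y\in\mathbb Q_p$, $x\equiv y\pmod{p^2}$ means $x-y\in p^2\mathbb Z_p$. *)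

theory Defs
  imports
    "HOL-Analysis.Analysis"
    "HOL-Computational_Algebra.Polynomial_Factorial"
    "Berlekamp_Zassenhaus.Finite_Field"
begin

text \<open>
  The prime \<open>p\<close> is encoded in a type \<open>'p\<close> with \<open>p = CARD('p)\<close>, class \<open>prime_card\<close> stating that
  this number is prime.  The ring of \<open>p\<close>-adic integers is the inverse limit of the rings
  \<open>\<int>/p\<^sup>n\<close>: the component \<open>f n\<close> is the representative in \<open>{0..<p\<^sup>n}\<close> of the residue modulo \<open>p\<^sup>n\<close>
  (the bounds follow from the coherence condition).
\<close>

typedef 'p padic_int =
    "{f :: nat \<Rightarrow> int. \<forall>n. f n = f (Suc n) mod int CARD('p::prime_card) ^ n}"
  morphisms padic_res Abs_padic_int
  by (rule exI[of _ "\<lambda>_. 0"]) simp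

setup_lifting type_definition_padic_int

lemma prime_CARD_pos [simp]: "0 < int CARD('p::prime_card)"
  using prime_card_int[where 'a='p] prime_gt_0_int by blast

lemma prime_CARD_gt_1: "1 < int CARD('p::prime_card)"
  using prime_card_int[where 'a='p] prime_gt_1_int by blast

lemma mod_Suc_power: "(x::int) mod q ^ Suc n mod q ^ n = x mod q ^ n"
  by (rule mod_mod_cancel) (simp add: le_imp_power_dvd)

lemma coherent_uminus:
  assumes "a = a' mod (q::int) ^ n"
  shows "(- a) mod q ^ n = (- a') mod q ^ Suc n mod q ^ n"
  unfolding mod_Suc_power assms by (rule mod_minus_eq)

lemma coherent_binop:
  assumes "a = a' mod (q::int) ^ n" and "b = b' mod q ^ n"
  shows coherent_plus: "(a + b) mod q ^ n = (a' + b') mod q ^ Suc n mod q ^ n"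
    and coherent_minus: "(a - b) mod q ^ n = (a' - b') mod q ^ Suc n mod q ^ n"
    and coherent_times: "(a * b) mod q ^ n = (a' * b') mod q ^ Suc n mod q ^ n"
  unfolding mod_Suc_power assms by (rule mod_add_eq mod_diff_eq mod_mult_eq)+

instantiation padic_int :: (prime_card) comm_ring_1
begin

lift_definition zero_padic_int :: "'a padic_int" is "\<lambda>_. 0" by simp

lift_definition one_padic_int :: "'a padic_int" is "\<lambda>n. 1 mod int CARD('a) ^ n"
  by (intro allI mod_Suc_power[symmetric])

lift_definition plus_padic_int :: "'a padic_int \<Rightarrow> 'a padic_int \<Rightarrow> 'a padic_int"
  is "\<lambda>f g n. (f n + g n) mod int CARD('a) ^ n"
  by (rule coherent_plus)

lift_definition minus_padic_int :: "'a padic_int \<Rightarrow> 'a padic_int \<Rightarrow> 'a padic_int"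
  is "\<lambda>f g n. (f n - g n) mod int CARD('a) ^ n"
  by (rule coherent_minus)

lift_definition uminus_padic_int :: "'a padic_int \<Rightarrow> 'a padic_int"
  is "\<lambda>f n. (- f n) mod int CARD('a) ^ n"
  by (rule coherent_uminus)

lift_definition times_padic_int :: "'a padic_int \<Rightarrow> 'a padic_int \<Rightarrow> 'a padic_int"
  is "\<lambda>f g n. (f n * g n) mod int CARD('a) ^ n"
  by (rule coherent_times)

instance
proof
  fix a b c :: "'a padic_int"
  have *: "f n mod int CARD('a) ^ n = f n"
    if "\<forall>n. f n = f (Suc n) mod int CARD('a) ^ n" for f :: "nat \<Rightarrow> int" and n
    by (subst (1 2) that[rule_format]) (rule mod_mod_trivial)
  show "a * b * c = a * (b * c)"
    by transfer (rule ext, simp (no_asm) add: mod_simps mult.assoc)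
  show "a * b = b * a"
    by transfer (rule ext, simp (no_asm) add: mult.commute)
  show "1 * a = a"
    by transfer (rule ext, simp (no_asm) add: mod_simps, rule *)
  show "a + b + c = a + (b + c)"
    by transfer (rule ext, simp (no_asm) add: mod_simps add.assoc)
  show "a + b = b + a"
    by transfer (rule ext, simp (no_asm) add: add.commute)
  show "0 + a = a"
    by transfer (rule ext, simp (no_asm), rule *)
  show "- a + a = 0"
    by transfer (rule ext, simp (no_asm) add: mod_simps)
  show "a - b = a + - b"
    by transfer (rule ext, simp (no_asm) add: mod_simps)
  show "(a + b) * c = a * c + b * c"
    by transfer (rule ext, simp (no_asm) add: mod_simps distrib_right)
  show "(0::'a padic_int) \<noteq> 1"
  proof transfer
    have "(0::int) \<noteq> 1 mod int CARD('a) ^ 1"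
      using prime_CARD_gt_1[where 'p='a] by simp
    thus "(\<lambda>_. 0) \<noteq> (\<lambda>n. 1 mod int CARD('a) ^ n)"
      by metis
  qed
qed

end

lemma padic_res_0 [simp]: "padic_res 0 n = 0"
  by transfer simp

lemma padic_res_bounds:
  fixes x :: "'p::prime_card padic_int"
  shows "padic_res x n \<ge> 0" "padic_res x n < int CARD('p) ^ n"
proof -
  have "padic_res x n = padic_res x (Suc n) mod int CARD('p) ^ n"
    using padic_res[of x] by blast
  thus "padic_res x n \<ge> 0" "padic_res x n < int CARD('p) ^ n"
    by (simp_all only: pos_mod_sign pos_mod_bound prime_CARD_pos zero_less_power)
qed

lemma padic_res_mod:
  fixes x :: "'p::prime_card padic_int"
  assumes "m \<le> n"
  shows "padic_res x n mod int CARD('p) ^ m = padic_res x m"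
  using assms
proof (induction n rule: dec_induct)
  case base
  show ?case by (simp add: padic_res_bounds)
next
  case (step n)
  have "padic_res x n = padic_res x (Suc n) mod int CARD('p) ^ n"
    using padic_res[of x] by blast
  moreover have "int CARD('p) ^ m dvd int CARD('p) ^ n"
    using step.hyps by (simp add: le_imp_power_dvd)
  ultimately show ?case
    using step.IH by (simp add: mod_mod_cancel)
qed

lemma padic_res_add: "padic_res (x + y) n = (padic_res x n + padic_res y n) mod int CARD('p) ^ n"
  and padic_res_diff: "padic_res (x - y) n = (padic_res x n - padic_res y n) mod int CARD('p) ^ n"
  and padic_res_mult: "padic_res (x * y) n = (padic_res x n * padic_res y n) mod int CARD('p) ^ n"
  for x y :: "'p::prime_card padic_int"
  by (transfer, rule refl)+

lemma padic_res_of_nat: "padic_res (of_nat k :: 'p padic_int) n = int k mod int CARD('p::prime_card) ^ n"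
proof (induction k)
  case (Suc k)
  have "padic_res (1 :: 'p padic_int) n = 1 mod int CARD('p) ^ n"
    by transfer simp
  thus ?case
    by (simp add: padic_res_add Suc mod_simps)
qed simp

lemma padic_int_eqI: "(\<And>n. padic_res x n = padic_res y n) \<Longrightarrow> x = y"
  by (metis ext padic_res_inject)

lemma padic_res_of_nat_power:
  "padic_res (of_nat CARD('p) ^ k :: 'p padic_int) n =
     int CARD('p::prime_card) ^ k mod int CARD('p) ^ n"
  by (simp only: of_nat_power[symmetric] padic_res_of_nat)

lemma p_power_dvd_padic_iff:
  fixes x :: "'p::prime_card padic_int"
  shows "of_nat CARD('p) ^ n dvd x \<longleftrightarrow> padic_res x n = 0"
proof
  assume "of_nat CARD('p) ^ n dvd x"
  then obtain z where "x = of_nat CARD('p) ^ n * z" by blast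
  thus "padic_res x n = 0"
    by (simp add: padic_res_mult padic_res_of_nat_power)
next
  assume x: "padic_res x n = 0"
  let ?p = "int CARD('p)"
  define f where "f k = padic_res x (n + k) div ?p ^ n" for k
  have dvd: "?p ^ n dvd padic_res x (n + k)" for k
    using padic_res_mod[of n "n + k" x] x by (simp add: dvd_eq_mod_eq_0)
  have "f k = f (Suc k) mod ?p ^ k" for k
  proof -
    have "padic_res x (n + k) = padic_res x (n + Suc k) mod (?p ^ n * ?p ^ k)"
      using padic_res_mod[of "n + k" "n + Suc k" x] by (simp add: power_add)
    also have "\<dots> = ?p ^ n * (f (Suc k) mod ?p ^ k)"
      using dvd[of "Suc k"] by (simp add: zmod_zmult2_eq f_def)
    finally show ?thesis
      by (simp add: f_def)
  qed
  hence f: "padic_res (Abs_padic_int f :: 'p padic_int) = f"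
    by (intro Abs_padic_int_inverse) blast
  have "x = of_nat CARD('p) ^ n * Abs_padic_int f"
  proof (rule padic_int_eqI)
    fix k
    have "padic_res (of_nat CARD('p) ^ n * Abs_padic_int f :: 'p padic_int) k =
            (?p ^ n * f k) mod ?p ^ k"
      by (simp add: padic_res_mult padic_res_of_nat_power f mod_simps)
    also have "\<dots> = padic_res x (n + k) mod ?p ^ k"
      using dvd[of k] by (simp add: f_def)
    also have "\<dots> = padic_res x k"
      by (simp add: padic_res_mod)
    finally show "padic_res x k = padic_res (of_nat CARD('p) ^ n * Abs_padic_int f :: 'p padic_int) k"
      by (rule sym)
  qed
  thus "of_nat CARD('p) ^ n dvd x" by simp
qed

lemma padic_int_nonzeroE:
  assumes "x \<noteq> 0"
  obtains n where "padic_res x n \<noteq> 0"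
  using assms padic_int_eqI[of x 0] by auto

instance padic_int :: (prime_card) idom
proof
  fix a b :: "'a padic_int"
  assume "a \<noteq> 0" "b \<noteq> 0"
  then obtain i j where ij: "padic_res a i \<noteq> 0" "padic_res b j \<noteq> 0"
    by (meson padic_int_nonzeroE)
  let ?p = "int CARD('a)" and ?a = "padic_res a (i + j)" and ?b = "padic_res b (i + j)"
  have p: "prime_elem ?p"
    using prime_card_int by blast
  have nd: "\<not> ?p ^ i dvd ?a" "\<not> ?p ^ j dvd ?b"
    using ij padic_res_mod[of i "i + j" a] padic_res_mod[of j "i + j" b]
    by (auto simp: dvd_eq_mod_eq_0)
  hence nz: "?a \<noteq> 0" "?b \<noteq> 0" by auto
  have npu: "\<not> is_unit ?p" using p by (rule prime_elem_not_unit)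
  have m: "multiplicity ?p ?a < i" "multiplicity ?p ?b < j"
    using nd nz npu by (auto simp: power_dvd_iff_le_multiplicity)
  have "\<not> ?p ^ (i + j) dvd ?a * ?b"
    using m nz npu p by (simp add: power_dvd_iff_le_multiplicity prime_elem_multiplicity_mult_distrib)
  hence "padic_res (a * b) (i + j) \<noteq> 0"
    by (simp add: padic_res_mult dvd_eq_mod_eq_0)
  thus "a * b \<noteq> 0" by auto
qed

instance padic_int :: (prime_card) ring_char_0
proof
  show "inj (of_nat :: nat \<Rightarrow> 'a padic_int)"
  proof (rule injI)
    fix k l :: nat
    assume eq: "(of_nat k :: 'a padic_int) = of_nat l"
    have "m < CARD('a) ^ Suc (k + l)" if "m \<le> k + l" for m
    proof -
      have "m < 2 ^ Suc (k + l)"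
        using that less_exp[of "Suc (k + l)"] by linarith
      also have "2 ^ Suc (k + l) \<le> CARD('a) ^ Suc (k + l)"
        using prime_card[where 'a='a] prime_ge_2_nat by (intro power_mono) auto
      finally show ?thesis .
    qed
    hence "int k < int CARD('a) ^ Suc (k + l)" "int l < int CARD('a) ^ Suc (k + l)"
      by (metis le_add1 le_add2 of_nat_less_iff of_nat_power)+
    moreover have "int k mod int CARD('a) ^ Suc (k + l) = int l mod int CARD('a) ^ Suc (k + l)"
      using eq padic_res_of_nat by metis
    ultimately show "k = l" by simp
  qed
qed

instance fract :: ("{idom,ring_char_0}") field_char_0
proof
  show "inj (of_nat :: nat \<Rightarrow> 'a fract)"
  proof (rule injI)
    fix m n :: nat
    assume "(of_nat m :: 'a fract) = of_nat n"
    hence "Fract (of_nat m :: 'a) 1 = Fract (of_nat n) 1"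
      by (simp only: Fract_of_nat_eq)
    hence "(of_nat m :: 'a) = of_nat n"
      by (simp only: eq_fract one_neq_zero mult_1_right not_False_eq_True simp_thms)
    thus "m = n"
      by (simp only: of_nat_eq_iff)
  qed
qed

definition padic_val :: "'p::prime_card padic_int \<Rightarrow> nat" where
  "padic_val x = (GREATEST n. of_nat CARD('p) ^ n dvd x)"

lemma p_power_dvd_padic_iff_val:
  fixes x :: "'p::prime_card padic_int"
  assumes "x \<noteq> 0"
  shows "of_nat CARD('p) ^ n dvd x \<longleftrightarrow> n \<le> padic_val x"
proof -
  obtain N where N: "padic_res x N \<noteq> 0"
    using assms by (rule padic_int_nonzeroE)
  have bd: "k \<le> N" if "of_nat CARD('p) ^ k dvd x" for k
    using that N by (metis le_imp_power_dvd dvd_trans nle_le p_power_dvd_padic_iff)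
  have "of_nat CARD('p) ^ padic_val x dvd x"
    unfolding padic_val_def by (rule GreatestI_nat[of _ 0 N]) (auto intro: bd)
  moreover have "n \<le> padic_val x" if "of_nat CARD('p) ^ n dvd x"
    unfolding padic_val_def using that bd by (rule Greatest_le_nat)
  moreover have "of_nat CARD('p) ^ n dvd x"
    if "n \<le> padic_val x" "of_nat CARD('p) ^ padic_val x dvd x"
    using le_imp_power_dvd[OF that(1)] that(2) by (rule dvd_trans)
  ultimately show ?thesis by blast
qed

instantiation padic_int :: (prime_card) metric_space
begin

definition dist_padic_int :: "'a padic_int \<Rightarrow> 'a padic_int \<Rightarrow> real" where
  "dist_padic_int x y = (if x = y then 0 else 1 / real CARD('a) ^ padic_val (x - y))"

definition uniformity_padic_int :: "('a padic_int \<times> 'a padic_int) filter" where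
  "uniformity_padic_int = (INF e\<in>{0<..}. principal {(x, y). dist x y < e})"

definition open_padic_int :: "'a padic_int set \<Rightarrow> bool" where
  "open_padic_int U \<longleftrightarrow> (\<forall>x\<in>U. \<forall>\<^sub>F (x', y) in uniformity. x' = x \<longrightarrow> y \<in> U)"

instance
proof
  fix x y z :: "'a padic_int"
  have p: "real CARD('a) > 1"
    using prime_gt_1_nat[OF prime_card[where 'a='a]] by simp
  show "dist x y = 0 \<longleftrightarrow> x = y"
    using p by (auto simp: dist_padic_int_def)
  show "dist x y \<le> dist x z + dist y z"
  proof (cases "x = y \<or> x = z \<or> y = z")
    case True
    have "of_nat CARD('a) ^ n dvd x - y \<longleftrightarrow> of_nat CARD('a) ^ n dvd y - x" for n
      by (metis dvd_minus_iff minus_diff_eq)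
    hence "dist x y = dist y x"
      unfolding dist_padic_int_def padic_val_def by (simp only: eq_commute[of x y])
    moreover have "dist u v \<ge> 0" "dist u u = 0" for u v :: "'a padic_int"
      by (simp_all add: dist_padic_int_def)
    ultimately show ?thesis
      using True by (elim disjE) simp_all
  next
    case False
    let ?m = "min (padic_val (x - z)) (padic_val (y - z))"
    have "of_nat CARD('a) ^ ?m dvd x - z" "of_nat CARD('a) ^ ?m dvd y - z"
      using False by (simp_all add: p_power_dvd_padic_iff_val)
    hence "of_nat CARD('a) ^ ?m dvd (x - z) - (y - z)"
      by (rule dvd_diff)
    hence "?m \<le> padic_val (x - y)"
      using False by (simp add: p_power_dvd_padic_iff_val)
    hence "1 / real CARD('a) ^ padic_val (x - y) \<le> 1 / real CARD('a) ^ ?m"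
      using p by (intro divide_left_mono power_increasing) auto
    also have "\<dots> \<le> dist x z + dist y z"
      using False p by (auto simp: dist_padic_int_def min_def)
    finally show ?thesis
      using False by (simp add: dist_padic_int_def)
  qed
next
  show "uniformity = (INF e\<in>{0<..}. principal {(x, y :: 'a padic_int). dist x y < e})"
    by (rule uniformity_padic_int_def)
  show "open U \<longleftrightarrow> (\<forall>x\<in>U. \<forall>\<^sub>F (x', y) in uniformity. x' = x \<longrightarrow> y \<in> U)"
    for U :: "'a padic_int set"
    by (rule open_padic_int_def)
qed

end

text \<open>The field \<open>\<rat>\<^sub>p\<close>; \<^const>\<open>to_fract\<close> is the inclusion of \<open>\<int>\<^sub>p\<close>.\<close>

type_synonym 'p padic = "'p padic_int fract"

definition padic_cong :: "nat \<Rightarrow> 'p::prime_card padic \<Rightarrow> 'p padic \<Rightarrow> bool" where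
  "padic_cong n x y \<longleftrightarrow> (\<exists>z :: 'p padic_int. x - y = of_nat CARD('p) ^ n * to_fract z)"

definition least_residue :: "'p::prime_card padic_int \<Rightarrow> int" where
  "least_residue x = (THE r. r \<in> {0..int CARD('p) - 1} \<and> of_nat CARD('p) dvd x - of_int r)"

definition trunc_hypergeom :: "'a::field_char_0 list \<Rightarrow> 'a list \<Rightarrow> 'a \<Rightarrow> nat \<Rightarrow> 'a" where
  "trunc_hypergeom as bs z n =
     (\<Sum>k=0..n. (\<Prod>a\<leftarrow>as. pochhammer a k) / (\<Prod>b\<leftarrow>bs. pochhammer b k) * (z ^ k / fact k))"

text \<open>The case \<open>n = 0\<close> of the following formula gives the required value \<open>1\<close>.\<close>

definition padic_Gamma_nat :: "nat \<Rightarrow> 'p::prime_card padic_int" where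
  "padic_Gamma_nat n = (-1) ^ n * (\<Prod>j | 1 \<le> j \<and> j < n \<and> \<not> CARD('p) dvd j. of_nat j)"

definition padic_Gamma :: "'p::prime_card padic_int \<Rightarrow> 'p padic_int" where
  "padic_Gamma = (THE g. continuous_on UNIV g \<and> (\<forall>n. g (of_nat n) = padic_Gamma_nat n))"

end

theory Submission
  imports Defs "HOL-Number_Theory.Residue_Primitive_Roots"
begin

text \<open>
  Put \<open>a, b, c = \<langle>-\<alpha>\<rangle>\<^sub>p, \<langle>-\<beta>\<rangle>\<^sub>p, \<langle>-\<gamma>\<rangle>\<^sub>p\<close> and write \<open>\<alpha> = -a + px\<close>, \<open>\<beta> = -b + py\<close>. The terms with \<open>k > c\<close>
  vanish modulo \<open>p\<^sup>2\<close>, and the remaining sum is a polynomial in \<open>\<alpha>, \<beta>\<close> with integral coefficients,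
  hence affine in \<open>(x, y)\<close> modulo \<open>p\<^sup>2\<close>. Since \<open>\<Gamma>\<^sub>p(w + pt)\<close> is also affine in \<open>t\<close> modulo \<open>p\<^sup>2\<close>, both
  sides of the congruence (cleared of the denominator of the Gamma quotient) are affine modulo \<open>p\<^sup>2\<close>,
  and it suffices to compare them on the lines \<open>x = 0\<close> and \<open>y = 0\<close>. There the series terminates and
  is evaluated exactly by the Pfaff--Saalschuetz identity; the functional equation of \<open>\<Gamma>\<^sub>p\<close> turns the
  resulting product into the Gamma quotient if \<open>a + b < c\<close>, while for \<open>a + b > p\<close> two of its factors
  are divisible by \<open>p\<close>.
\<close>

section \<open>A terminating Saalschuetzian sum\<close>

text \<open>The upper parameters \<open>- of_nat n\<close>, \<open>b\<close>,
  \<open>g - b + of_nat n\<close> add up to \<open>g\<close> and the lower ones, \<open>1\<close>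
  and \<open>g\<close>, to \<open>g + 1\<close>. So the series at argument 1 is balanced, as the
  Pfaff-Saalschuetz theorem requires. The lower parameter 1 accounts for the second
  factorial.\<close>

definition saal_term :: "'a::field_char_0 \<Rightarrow> 'a \<Rightarrow> nat \<Rightarrow> nat \<Rightarrow> 'a" where
  "saal_term b g n k =
     pochhammer (- of_nat n) k * pochhammer b k * pochhammer (g - b + of_nat n) k /
     (fact k ^ 2 * pochhammer g k)"

text \<open>The right-hand side below is the antidifference that Zeilberger's algorithm produces for the
  first-order recurrence in \<open>n\<close> satisfied by the sum.\<close>
lemma saal_term_telescope:
  fixes b g :: "'a::field_char_0"
  assumes "pochhammer g (Suc n) \<noteq> 0" "m \<le> Suc n"
  shows "(\<Sum>k\<le>m. (of_nat n + 1) * (g + of_nat n) * saal_term b g (Suc n) k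
                   - (of_nat n + 1 - b) * (g - b + of_nat n) * saal_term b g n k) =
         (g - b + 2 * of_nat n + 1) * pochhammer (- of_nat n) m * pochhammer b (Suc m) *
           pochhammer (g - b + of_nat n + 1) m / (fact m ^ 2 * pochhammer g m)"
  using assms(2)
proof (induction m)
  case 0
  show ?case by (simp add: saal_term_def algebra_simps)
next
  case (Suc m)
  define N M s where "N = (of_nat n :: 'a)" and "M = (of_nat m :: 'a)" and "s = g - b"
  define A B C where "A = pochhammer (- N) m" and "B = pochhammer b m"
    and "C = pochhammer (s + N + 1) m"
  define D where "D = (fact m ^ 2 :: 'a) * pochhammer g m"
  \<comment> \<open>\<open>E\<close> is the quotient of the denominators at \<open>Suc m\<close> and
    \<open>m\<close>. All terms below then share the denominator \<open>D * E\<close> and the factor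
    \<open>A * (B * (b + M)) * C\<close>.\<close>
  define E where "E = (M + 1)^2 * (g + M)"
  have g: "g = s + b" by (simp add: s_def)
  have "pochhammer g (Suc m) \<noteq> 0"
    using assms(1) pochhammer_eq_0_mono Suc.prems by blast
  hence nz: "pochhammer g m \<noteq> 0" "g + M \<noteq> 0"
    by (auto simp: pochhammer_Suc M_def)
  have "M + 1 \<noteq> 0"
    unfolding M_def by (metis of_nat_Suc add.commute of_nat_eq_0_iff nat.distinct(2))
  hence D0: "D \<noteq> 0" and E0: "E \<noteq> 0" using nz by (auto simp: D_def E_def)
  have DE: "fact (Suc m) ^ 2 * pochhammer g (Suc m) = D * E"
    by (simp add: D_def E_def pochhammer_Suc M_def power2_eq_square algebra_simps)
  have t1: "saal_term b g (Suc n) (Suc m) =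
              (- N - 1) * A * (B * (b + M)) * (C * (s + N + 1 + M)) / (D * E)"
  proof -
    have "pochhammer (- of_nat (Suc n)) (Suc m) = (- N - 1) * A"
      by (simp add: pochhammer_rec A_def N_def algebra_simps)
    moreover have "pochhammer (g - b + of_nat (Suc n)) (Suc m) = C * (s + N + 1 + M)"
      by (simp add: pochhammer_Suc C_def N_def M_def s_def algebra_simps)
    ultimately show ?thesis
      by (simp add: saal_term_def DE pochhammer_Suc[of b] B_def M_def mult.assoc del: fact_Suc)
  qed
  have t2: "saal_term b g n (Suc m) =
              (A * (M - N)) * (B * (b + M)) * ((s + N) * C) / (D * E)"
  proof -
    have "pochhammer (- of_nat n) (Suc m) = A * (M - N)"
      by (simp add: pochhammer_Suc A_def M_def N_def algebra_simps)
    moreover have "pochhammer (g - b + of_nat n) (Suc m) = (s + N) * C"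
      by (simp add: pochhammer_rec C_def N_def s_def)
    ultimately show ?thesis
      by (simp add: saal_term_def DE pochhammer_Suc[of b] B_def M_def mult.assoc del: fact_Suc)
  qed
  have IH: "(\<Sum>k\<le>m. (of_nat n + 1) * (g + of_nat n) * saal_term b g (Suc n) k
                   - (of_nat n + 1 - b) * (g - b + of_nat n) * saal_term b g n k) =
            (s + 2 * N + 1) * A * (B * (b + M)) * C * E / (D * E)"
    using Suc E0 by (simp add: A_def B_def C_def D_def s_def N_def M_def pochhammer_Suc)
  have "(\<Sum>k\<le>Suc m. (of_nat n + 1) * (g + of_nat n) * saal_term b g (Suc n) k
                   - (of_nat n + 1 - b) * (g - b + of_nat n) * saal_term b g n k) =
        (s + 2 * N + 1) * A * (B * (b + M)) * C * E / (D * E) +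
        ((N + 1) * (g + N) * ((- N - 1) * A * (B * (b + M)) * (C * (s + N + 1 + M)) / (D * E))
         - (N + 1 - b) * (s + N) * ((A * (M - N)) * (B * (b + M)) * ((s + N) * C) / (D * E)))"
    unfolding sum.atMost_Suc IH t1 t2 by (simp only: N_def s_def)
  also have "\<dots> = ((s + 2 * N + 1) * A * (B * (b + M)) * C * E +
        ((N + 1) * (g + N) * ((- N - 1) * A * (B * (b + M)) * (C * (s + N + 1 + M)))
         - (N + 1 - b) * (s + N) * ((A * (M - N)) * (B * (b + M)) * ((s + N) * C)))) / (D * E)"
    by (simp add: add_divide_distrib diff_divide_distrib)
  also have "(s + 2 * N + 1) * A * (B * (b + M)) * C * E +
        ((N + 1) * (g + N) * ((- N - 1) * A * (B * (b + M)) * (C * (s + N + 1 + M)))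
         - (N + 1 - b) * (s + N) * ((A * (M - N)) * (B * (b + M)) * ((s + N) * C))) =
      (s + 2 * N + 1) * (A * (M - N)) * (B * (b + M) * (b + M + 1)) * (C * (s + N + 1 + M))"
  proof -
    \<comment> \<open>With the common factor \<open>A * (B * (b + M)) * C\<close> split off, the
      induction step is this polynomial identity.\<close>
    have "(s + 2 * N + 1) * E - (N + 1)^2 * (g + N) * (s + N + 1 + M)
            - (N + 1 - b) * (s + N)^2 * (M - N) =
          (s + 2 * N + 1) * (M - N) * (b + M + 1) * (s + N + 1 + M)"
      unfolding E_def g by (simp add: algebra_simps power2_eq_square)
    from arg_cong[OF this, of "\<lambda>z. A * (B * (b + M)) * C * z"] show ?thesis
      by (simp add: algebra_simps power2_eq_square)
  qed
  also have "\<dots> / (D * E) = (g - b + 2 * of_nat n + 1) * pochhammer (- of_nat n) (Suc m) *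
           pochhammer b (Suc (Suc m)) *
           pochhammer (g - b + of_nat n + 1) (Suc m) / (fact (Suc m) ^ 2 * pochhammer g (Suc m))"
    unfolding DE
    by (simp add: pochhammer_Suc A_def B_def C_def N_def M_def s_def add_ac)
  finally show ?case .
qed

text \<open>Summed up to \<open>Suc n\<close>, the telescoped identity has right-hand side 0,
  because it contains the Pochhammer symbol \<open>(-n)_(n+1)\<close>. What remains is a first-order
  recurrence in \<open>n\<close>, which the product on the right satisfies as well; both sides are 1
  at \<open>n = 0\<close>.\<close>

theorem saalschutz_lower_one:
  fixes b g :: "'a::field_char_0"
  assumes "pochhammer g n \<noteq> 0"
  shows "(\<Sum>k\<le>n. saal_term b g n k) =
           pochhammer (1 - b) n * pochhammer (g - b) n / (fact n * pochhammer g n)"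
  using assms
proof (induction n)
  case 0
  show ?case by (simp add: saal_term_def)
next
  case (Suc n)
  have nz: "pochhammer g n \<noteq> 0" "g + of_nat n \<noteq> 0"
    using Suc.prems by (auto simp: pochhammer_Suc)
  have n1: "(of_nat n + 1 :: 'a) \<noteq> 0"
    by (metis of_nat_Suc add.commute of_nat_eq_0_iff nat.distinct(2))
  have "pochhammer (- of_nat n :: 'a) (Suc n) = 0"
    by (simp add: pochhammer_Suc)
  with saal_term_telescope[OF Suc.prems order.refl, of b]
  have "(of_nat n + 1) * (g + of_nat n) * (\<Sum>k\<le>Suc n. saal_term b g (Suc n) k) =
        (of_nat n + 1 - b) * (g - b + of_nat n) * (\<Sum>k\<le>Suc n. saal_term b g n k)"
    by (simp add: sum_subtractf sum_distrib_left del: sum.atMost_Suc)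
  also have "(\<Sum>k\<le>Suc n. saal_term b g n k) = (\<Sum>k\<le>n. saal_term b g n k)"
    by (simp add: saal_term_def pochhammer_Suc)
  also have "\<dots> = pochhammer (1 - b) n * pochhammer (g - b) n / (fact n * pochhammer g n)"
    using Suc.IH nz by blast
  finally have "(\<Sum>k\<le>Suc n. saal_term b g (Suc n) k) =
    (of_nat n + 1 - b) * (g - b + of_nat n) *
      (pochhammer (1 - b) n * pochhammer (g - b) n / (fact n * pochhammer g n)) /
    ((of_nat n + 1) * (g + of_nat n))"
    using nz n1 by (simp add: nonzero_eq_divide_eq mult.commute del: sum.atMost_Suc times_divide_eq_right times_divide_eq_left)
  also have "\<dots> = pochhammer (1 - b) (Suc n) * pochhammer (g - b) (Suc n) /
      (fact (Suc n) * pochhammer g (Suc n))"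
  proof -
    have "pochhammer (1 - b) (Suc n) = pochhammer (1 - b) n * (of_nat n + 1 - b)"
      by (simp add: pochhammer_Suc add_ac diff_add_eq)
    thus ?thesis
      by (simp add: pochhammer_Suc[of g] pochhammer_Suc[of "g - b"] mult_ac add.commute[of 1])
  qed
  finally show ?case .
qed

section \<open>The ring of p-adic integers\<close>

lemma padic_res_of_int:
  "padic_res (of_int r :: 'p::prime_card padic_int) n = r mod int CARD('p) ^ n"
proof (cases r)
  case (nonneg k)
  thus ?thesis by (simp add: padic_res_of_nat)
next
  case (neg k)
  have "padic_res (- of_nat (Suc k) :: 'p padic_int) n =
          padic_res (0 - of_nat (Suc k) :: 'p padic_int) n" by simp
  also have "\<dots> = (- int (Suc k)) mod int CARD('p) ^ n"
    by (simp only: padic_res_diff padic_res_of_nat padic_res_0 mod_simps) simp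
  finally show ?thesis using neg by (simp only: of_int_minus of_int_of_nat_eq)
qed

lemma p_power_dvd_diff_iff:
  fixes x y :: "'p::prime_card padic_int"
  shows "of_nat CARD('p) ^ n dvd x - y \<longleftrightarrow> padic_res x n = padic_res y n"
proof -
  have "padic_res (x - y) n = 0 \<longleftrightarrow> padic_res x n mod int CARD('p) ^ n = padic_res y n mod int CARD('p) ^ n"
    unfolding padic_res_diff by (simp add: mod_eq_dvd_iff dvd_eq_mod_eq_0)
  thus ?thesis unfolding p_power_dvd_padic_iff by (simp add: padic_res_mod)
qed

lemma p_dvd_diff_iff:
  fixes x y :: "'p::prime_card padic_int"
  shows "of_nat CARD('p) dvd x - y \<longleftrightarrow> padic_res x 1 = padic_res y 1"
  using p_power_dvd_diff_iff[of 1 x y] by simp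

lemma least_residue_eq: "least_residue x = padic_res x 1"
  for x :: "'p::prime_card padic_int"
  unfolding least_residue_def
proof (rule the_equality)
  show "padic_res x 1 \<in> {0..int CARD('p) - 1} \<and> of_nat CARD('p) dvd x - of_int (padic_res x 1)"
    using padic_res_bounds[of x 1] unfolding p_dvd_diff_iff padic_res_of_int by simp
next
  fix r assume "r \<in> {0..int CARD('p) - 1} \<and> of_nat CARD('p) dvd x - of_int r"
  thus "r = padic_res x 1"
    unfolding p_dvd_diff_iff padic_res_of_int by simp
qed

lemma of_int_p_power_dvd_iff:
  "of_nat CARD('p) ^ n dvd (of_int r :: 'p::prime_card padic_int) \<longleftrightarrow> int CARD('p) ^ n dvd r"
  by (simp add: p_power_dvd_padic_iff padic_res_of_int dvd_eq_mod_eq_0)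

lemma of_int_p_dvd_iff:
  "of_nat CARD('p) dvd (of_int r :: 'p::prime_card padic_int) \<longleftrightarrow> int CARD('p) dvd r"
  using of_int_p_power_dvd_iff[of 1 r] by simp

lemma of_nat_p_dvd_iff:
  "of_nat CARD('p) dvd (of_nat r :: 'p::prime_card padic_int) \<longleftrightarrow> CARD('p) dvd r"
  using of_int_p_dvd_iff[of "int r"] by simp

lemma prime_elem_p: "prime_elem (of_nat CARD('p) :: 'p::prime_card padic_int)"
proof (rule prime_elemI)
  let ?p = "of_nat CARD('p) :: 'p padic_int"
  show "?p \<noteq> 0" by simp
  show "\<not> ?p dvd 1"
    using of_int_p_dvd_iff[of 1, where 'p='p] prime_CARD_gt_1[where 'p='p] by simp
  fix a b assume "?p dvd a * b"
  hence "padic_res (a * b) 1 = 0" using p_power_dvd_padic_iff[of 1 "a * b"] by simp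
  hence "int CARD('p) dvd padic_res a 1 * padic_res b 1"
    unfolding padic_res_mult by (simp add: dvd_eq_mod_eq_0)
  hence "int CARD('p) dvd padic_res a 1 \<or> int CARD('p) dvd padic_res b 1"
    using prime_card_int[where 'a='p] by (simp add: prime_dvd_mult_iff)
  moreover have "of_nat CARD('p) dvd x" if "int CARD('p) dvd padic_res x 1" for x :: "'p padic_int"
    using that padic_res_bounds[of x 1] p_power_dvd_padic_iff[of 1 x] by (auto simp: zdvd_not_zless less_le)
  ultimately show "?p dvd a \<or> ?p dvd b" by blast
qed

text \<open>Lets identities between p-adic integers be proved modulo one power of p at a time, as is
  done below for \<open>\<Gamma>\<^sub>p\<close>.\<close>

lemma padic_int_eq_0I:
  fixes x :: "'p::prime_card padic_int"
  assumes "\<And>n. of_nat CARD('p) ^ n dvd x"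
  shows "x = 0"
  using assms by (intro padic_int_eqI) (simp add: p_power_dvd_padic_iff)

text \<open>The residue of \<open>x\<close> modulo each \<open>p ^ n\<close> is invertible, and the
  inverses, reduced to the standard range, are coherent because an inverse modulo
  \<open>p ^ n\<close> is unique.\<close>

lemma padic_unit:
  fixes x :: "'p::prime_card padic_int"
  assumes "\<not> of_nat CARD('p) dvd x"
  obtains y where "x * y = 1"
proof -
  let ?p = "int CARD('p)"
  have cop: "coprime (padic_res x n) (?p ^ n)" for n
  proof (cases n)
    case (Suc m)
    have "padic_res x n mod ?p = padic_res x 1"
      using padic_res_mod[of 1 n x] Suc by simp
    moreover have "padic_res x 1 \<noteq> 0"
      using assms p_power_dvd_padic_iff[of 1 x] by simp
    ultimately have "\<not> ?p dvd padic_res x n" by (auto simp: dvd_eq_mod_eq_0)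
    thus ?thesis
      using prime_card_int[where 'a='p] by (metis coprime_commute coprime_power_right_iff prime_imp_coprime)
  qed simp
  have "\<forall>n. \<exists>y. [padic_res x n * y = 1] (mod ?p ^ n)"
    using cop cong_solve_coprime_int by blast
  then obtain f where f: "\<And>n. [padic_res x n * f n = 1] (mod ?p ^ n)" by metis
  define g where "g n = f n mod ?p ^ n" for n
  have g: "[padic_res x n * g n = 1] (mod ?p ^ n)" for n
    using f[of n] by (simp add: g_def cong_def mod_mult_right_eq)
  have "g n = g (Suc n) mod ?p ^ n" for n
  proof -
    have "[padic_res x (Suc n) * g (Suc n) = 1] (mod ?p ^ n)"
      using g[of "Suc n"] by (rule cong_dvd_modulus) simp
    moreover have "[padic_res x (Suc n) = padic_res x n] (mod ?p ^ n)"
      using padic_res_mod[of n "Suc n" x] padic_res_mod[of n n x] by (simp add: cong_def)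
    ultimately have "[padic_res x n * g (Suc n) = padic_res x n * g n] (mod ?p ^ n)"
      by (meson cong_scalar_right cong_sym cong_trans g)
    hence "[g (Suc n) = g n] (mod ?p ^ n)"
      using cop[of n] by (simp add: cong_mult_lcancel)
    thus ?thesis by (simp add: cong_def g_def)
  qed
  hence inv: "padic_res (Abs_padic_int g :: 'p padic_int) = g"
    by (intro Abs_padic_int_inverse) blast
  have one: "padic_res (1 :: 'p padic_int) n = 1 mod ?p ^ n" for n
    using padic_res_of_int[of 1 n, where 'p='p] by simp
  have "x * Abs_padic_int g = 1"
    using g by (intro padic_int_eqI) (simp add: padic_res_mult inv one cong_def)
  thus ?thesis by (rule that)
qed

lemma padic_approx_nat:
  fixes x :: "'p::prime_card padic_int"
  obtains n :: nat where "of_nat CARD('p) ^ k dvd x - of_nat n"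
proof
  show "of_nat CARD('p) ^ k dvd x - of_nat (nat (padic_res x k))"
    unfolding p_power_dvd_diff_iff padic_res_of_nat using padic_res_bounds[of x k] by simp
qed

section \<open>Morita's Gamma function\<close>

text \<open>Wilson's theorem for prime powers. A primitive root \<open>g\<close> turns the product
  into a power of \<open>g\<close> whose exponent is the sum of all
  \<open>i < totient m = 2 * h\<close>, namely \<open>h * (2 * h - 1)\<close>. Since
  \<open>g ^ h\<close> is congruent to -1, an odd power of -1 remains.\<close>

lemma prod_totatives_odd_prime_power:
  assumes p: "prime p" "odd p" and k: "k > 0"
  shows "[(\<Prod>j\<in>totatives (p ^ k). int j) = - 1] (mod int p ^ k)"
proof -
  define m where "m = p ^ k"
  obtain g where "\<forall>k>0. residue_primroot (p ^ k) g"
    using residue_primroot_odd_prime_power_exists[OF p] by blast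
  hence g: "residue_primroot m g" using k by (simp add: m_def)
  have m1: "m > 1" using p k unfolding m_def by (meson one_less_power prime_gt_1_nat)
  have m2: "m > 2"
  proof -
    have "odd m" using p by (simp add: m_def)
    hence "m \<noteq> 2" by auto
    thus ?thesis using m1 by linarith
  qed
  obtain h where h: "totient m = 2 * h"
    using totient_even[OF m2] by blast
  have h0: "h > 0" using h m1 by (cases h) auto
  have ordg: "ord m g = totient m" using g by (simp add: residue_primroot_def)
  have "[g ^ (2 * h) = 1] (mod m)" using ord_works[of g m] ordg h by simp
  hence sq: "[int g ^ (2 * h) = 1] (mod int m)"
    by (metis cong_int_iff of_nat_1 of_nat_power)
  have ne: "\<not> [int g ^ h = 1] (mod int m)"
  proof
    assume "[int g ^ h = 1] (mod int m)"
    hence "[g ^ h = 1] (mod m)" by (metis cong_int_iff of_nat_1 of_nat_power)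
    hence "ord m g dvd h" by (simp add: ord_divides')
    thus False using ordg h h0 by (auto dest: dvd_imp_le)
  qed
  define x where "x = int g ^ h"
  have pr: "prime (int p)" using p by simp
  have "(x - 1) * (x + 1) = int g ^ (2 * h) - 1"
    by (simp add: x_def power_mult power_mult_distrib power2_eq_square algebra_simps mult_2 power_add)
  hence dv: "int p ^ k dvd (x - 1) * (x + 1)"
    using sq by (simp add: cong_iff_dvd_diff m_def)
  \<comment> \<open>\<open>x\<close> is a square root of 1 modulo \<open>p ^ k\<close>. As p is odd,
    it divides at most one of \<open>x - 1\<close> and \<open>x + 1\<close>, so the whole power
    divides one of them; the order of \<open>g\<close> rules out \<open>x - 1\<close>.\<close>
  have nb: "\<not> (int p dvd x - 1 \<and> int p dvd x + 1)"
  proof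
    assume "int p dvd x - 1 \<and> int p dvd x + 1"
    hence "int p dvd (x + 1) - (x - 1)" using dvd_diff by blast
    hence "int p dvd int 2" by simp
    hence "p dvd 2" by (simp only: int_dvd_int_iff)
    thus False using p by (metis primes_dvd_imp_eq two_is_prime_nat even_numeral dvd_refl)
  qed
  have "int p ^ k dvd x - 1 \<or> int p ^ k dvd x + 1"
  proof (cases "int p dvd x - 1")
    case True
    hence "coprime (int p ^ k) (x + 1)"
      using nb pr by (simp add: prime_imp_coprime)
    thus ?thesis using dv by (simp add: coprime_dvd_mult_left_iff)
  next
    case False
    hence "coprime (int p ^ k) (x - 1)"
      using pr by (simp add: prime_imp_coprime)
    thus ?thesis using dv by (simp add: coprime_dvd_mult_right_iff)
  qed
  hence xm: "[x = - 1] (mod int p ^ k)"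
    using ne by (auto simp: cong_iff_dvd_diff m_def x_def)
  have "(\<Prod>j\<in>totatives m. int j) = (\<Prod>i<totient m. int (g ^ i mod m))"
    using residue_primroot_is_generator[OF m1 g]
    by (subst prod.reindex_bij_betw[symmetric]) auto
  also have "[\<dots> = (\<Prod>i<totient m. int g ^ i)] (mod int m)"
    by (intro cong_prod) (simp add: zmod_int)
  also have "(\<Prod>i<totient m. int g ^ i) = int g ^ (\<Sum>i<totient m. i)"
    by (simp add: power_sum)
  also have "(\<Sum>i<totient m. i) = h * (2 * h - 1)"
  proof -
    have "2 * (\<Sum>i<n. i) = n * (n - 1)" for n :: nat
    proof (induction n)
      case (Suc n)
      thus ?case by (cases n) auto
    qed simp
    from this[of "totient m"] show ?thesis unfolding h by simp
  qed
  also have "int g ^ \<dots> = x ^ (2 * h - 1)" by (simp add: x_def power_mult)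
  also have "[\<dots> = (-1) ^ (2 * h - 1)] (mod int m)"
    using cong_pow[OF xm] by (simp add: m_def)
  also have "(-1 :: int) ^ (2 * h - 1) = -1" using h0 by simp
  finally show ?thesis by (simp add: m_def)
qed

section \<open>Morita's function at the natural numbers\<close>

lemma padic_Gamma_nat_0 [simp]: "padic_Gamma_nat 0 = 1"
  by (simp add: padic_Gamma_nat_def)

lemma padic_Gamma_nat_Suc:
  "(padic_Gamma_nat (Suc n) :: 'p::prime_card padic_int) =
     (if CARD('p) dvd n then - 1 else - of_nat n) * padic_Gamma_nat n"
proof -
  let ?A = "\<lambda>n. {j. 1 \<le> j \<and> j < n \<and> \<not> CARD('p) dvd j}"
  have "?A (Suc n) = (if CARD('p) dvd n then ?A n else insert n (?A n))"
  proof (cases "CARD('p) dvd n")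
    case True thus ?thesis by (auto simp: less_Suc_eq)
  next
    case False
    hence "n \<noteq> 0" by (metis dvd_0_right)
    thus ?thesis using False by (auto simp: less_Suc_eq)
  qed
  thus ?thesis by (simp add: padic_Gamma_nat_def)
qed

text \<open>Induction on \<open>n\<close>. At 0 this is Wilson's theorem modulo
  \<open>p ^ k\<close>. In the step, the recursion factors at \<open>n\<close> and
  \<open>n + p ^ k\<close> agree modulo \<open>p ^ k\<close>, because p divides both arguments or
  neither.\<close>

lemma padic_Gamma_nat_add_p_power:
  assumes odd: "odd CARD('p::prime_card)"
  shows "of_nat CARD('p) ^ k dvd
           (padic_Gamma_nat (n + CARD('p) ^ k) - padic_Gamma_nat n :: 'p padic_int)"
proof (cases "k = 0")
  case False
  hence k: "k > 0" by simp
  let ?q = "CARD('p) ^ k"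
  have pr: "prime CARD('p)" by (rule prime_card)
  show ?thesis
  proof (induction n)
    case 0
    have "{j. 1 \<le> j \<and> j < ?q \<and> \<not> CARD('p) dvd j} = totatives ?q"
    proof (intro equalityI subsetI)
      fix j assume "j \<in> {j. 1 \<le> j \<and> j < ?q \<and> \<not> CARD('p) dvd j}"
      thus "j \<in> totatives ?q"
        using pr prime_imp_coprime[of "CARD('p)" j]
        by (auto simp: totatives_def coprime_commute)
    next
      fix j assume j: "j \<in> totatives ?q"
      hence "coprime j CARD('p)" "j \<le> ?q" "j > 0" using k by (auto simp: totatives_def)
      moreover from this have "\<not> CARD('p) dvd j"
        using pr by (metis coprime_absorb_right coprime_commute not_prime_unit)
      moreover from this have "j \<noteq> ?q" using k by auto
      ultimately show "j \<in> {j. 1 \<le> j \<and> j < ?q \<and> \<not> CARD('p) dvd j}" by auto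
    qed
    \<comment> \<open>The sign \<open>(-1) ^ (p ^ k)\<close> is -1 because p is odd; it offsets the
      -1 in Wilson's theorem.\<close>
    hence "(padic_Gamma_nat ?q :: 'p padic_int) - 1 = - of_int ((\<Prod>j\<in>totatives ?q. int j) - (- 1))"
      using odd by (simp add: padic_Gamma_nat_def)
    moreover have "int CARD('p) ^ k dvd (\<Prod>j\<in>totatives ?q. int j) - (- 1)"
      using prod_totatives_odd_prime_power[OF pr odd k] by (simp only: cong_iff_dvd_diff)
    ultimately show ?case
      by (simp only: dvd_minus_iff of_int_p_power_dvd_iff add_0 padic_Gamma_nat_0)
  next
    case (Suc n)
    define u :: "nat \<Rightarrow> 'p padic_int"
      where "u n = (if CARD('p) dvd n then - 1 else - of_nat n)" for n
    have "CARD('p) dvd n + ?q \<longleftrightarrow> CARD('p) dvd n"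
      using k by (simp add: dvd_add_left_iff)
    hence "of_nat CARD('p) ^ k dvd u (n + ?q) - u n" by (simp add: u_def)
    hence "of_nat CARD('p) ^ k dvd
      (u (n + ?q) - u n) * padic_Gamma_nat (n + ?q) +
        u n * (padic_Gamma_nat (n + ?q) - padic_Gamma_nat n)"
      using Suc.IH by (intro dvd_add dvd_mult dvd_mult2)
    also have "\<dots> = padic_Gamma_nat (Suc n + ?q) - padic_Gamma_nat (Suc n)"
      by (simp add: padic_Gamma_nat_Suc u_def[symmetric] algebra_simps)
    finally show ?case .
  qed
qed simp

lemma padic_Gamma_nat_cong:
  assumes odd: "odd CARD('p::prime_card)" and mn: "[m = n] (mod CARD('p) ^ k)"
  shows "of_nat CARD('p) ^ k dvd (padic_Gamma_nat m - padic_Gamma_nat n :: 'p padic_int)"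
proof -
  have *: "of_nat CARD('p) ^ k dvd (padic_Gamma_nat (n + i * CARD('p) ^ k) - padic_Gamma_nat n :: 'p padic_int)"
    for n i
  proof (induction i)
    case (Suc i)
    from dvd_add[OF padic_Gamma_nat_add_p_power[OF odd, of k "n + i * CARD('p) ^ k"] Suc]
    show ?case by (simp add: add_ac)
  qed simp
  have **: "of_nat CARD('p) ^ k dvd (padic_Gamma_nat m - padic_Gamma_nat n :: 'p padic_int)"
    if "[m = n] (mod CARD('p) ^ k)" "n \<le> m" for m n
  proof -
    obtain i where "m = n + i * CARD('p) ^ k"
      using \<open>[m = n] (mod CARD('p) ^ k)\<close> \<open>n \<le> m\<close>
      by (metis cong_le_nat cong_sym add.commute mult.commute)
    thus ?thesis using * by simp
  qed
  show ?thesis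
  proof (cases "n \<le> m")
    case True thus ?thesis using ** mn by blast
  next
    case False
    hence "of_nat CARD('p) ^ k dvd (padic_Gamma_nat n - padic_Gamma_nat m :: 'p padic_int)"
      using **[of n m] mn by (simp add: cong_sym)
    thus ?thesis by (metis dvd_minus_iff minus_diff_eq)
  qed
qed


section \<open>Extension to the p-adic integers by continuity\<close>

lemma padic_tendstoI:
  fixes f :: "nat \<Rightarrow> 'p::prime_card padic_int"
  assumes "\<And>k. of_nat CARD('p) ^ k dvd f k - x"
  shows "f \<longlonglongrightarrow> x"
proof (rule metric_tendsto_imp_tendsto[OF _ always_eventually])
  have p: "real CARD('p) > 1"
    using prime_gt_1_nat[OF prime_card[where 'a='p]] by simp
  show "(\<lambda>k. (1 / real CARD('p)) ^ k) \<longlonglongrightarrow> 0"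
    using p by (intro LIMSEQ_realpow_zero) auto
  show "\<forall>k. dist (f k) x \<le> dist ((1 / real CARD('p)) ^ k) 0"
  proof
    fix k
    have "k \<le> padic_val (f k - x)" if "f k \<noteq> x"
      using assms[of k] that by (simp add: p_power_dvd_padic_iff_val)
    thus "dist (f k) x \<le> dist ((1 / real CARD('p)) ^ k) 0"
      using p by (auto simp: dist_padic_int_def power_one_over intro!: divide_left_mono power_increasing)
  qed
qed

text \<open>The hypothesis means that \<open>g\<close> does not increase p-adic distances.\<close>

lemma continuous_on_padicI:
  fixes g :: "'p::prime_card padic_int \<Rightarrow> 'p padic_int"
  assumes "\<And>k x y. of_nat CARD('p) ^ k dvd x - y \<Longrightarrow> of_nat CARD('p) ^ k dvd g x - g y"
  shows "continuous_on UNIV g"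
proof -
  have p: "real CARD('p) > 1"
    using prime_gt_1_nat[OF prime_card[where 'a='p]] by simp
  have "dist (g x) (g y) \<le> dist x y" for x y
  proof (cases "g x = g y")
    case False
    hence "x \<noteq> y" by auto
    hence "of_nat CARD('p) ^ padic_val (x - y) dvd g x - g y"
      by (intro assms) (simp add: p_power_dvd_padic_iff_val)
    hence "padic_val (x - y) \<le> padic_val (g x - g y)"
      using False by (simp add: p_power_dvd_padic_iff_val)
    thus ?thesis
      using False \<open>x \<noteq> y\<close> p
      by (auto simp: dist_padic_int_def intro!: divide_left_mono power_increasing)
  qed (simp add: dist_padic_int_def)
  thus ?thesis
    unfolding continuous_on_iff by (meson le_less_trans)
qed

text \<open>Modulo \<open>p ^ k\<close> the value at \<open>x\<close> has to be that of
  \<open>padic_Gamma_nat\<close> at any natural number congruent to \<open>x\<close>. By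
  \<open>padic_Gamma_nat_cong\<close> the choice does not matter, and the residues
  \<open>G x k\<close> are coherent.\<close>

lemma padic_Gamma_exists:
  assumes odd: "odd CARD('p::prime_card)"
  obtains g :: "'p::prime_card padic_int \<Rightarrow> 'p padic_int"
  where "\<And>k x n. of_nat CARD('p) ^ k dvd x - of_nat n \<Longrightarrow>
           of_nat CARD('p) ^ k dvd g x - padic_Gamma_nat n"
proof -
  define G where
    "G x k = padic_res (padic_Gamma_nat (nat (padic_res x k)) :: 'p padic_int) k"
    for x :: "'p padic_int" and k
  have cong: "padic_res (padic_Gamma_nat m :: 'p padic_int) k = padic_res (padic_Gamma_nat n :: 'p padic_int) k"
    if "int m mod int CARD('p) ^ k = int n mod int CARD('p) ^ k" for m n k
  proof -
    have "[m = n] (mod CARD('p) ^ k)"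
      using that unfolding cong_def by (metis of_nat_eq_iff of_nat_mod of_nat_power)
    from padic_Gamma_nat_cong[OF odd this] show ?thesis
      by (simp only: p_power_dvd_diff_iff)
  qed
  have "G x k = G x (Suc k) mod int CARD('p) ^ k" for x k
  proof -
    have "G x (Suc k) mod int CARD('p) ^ k =
            padic_res (padic_Gamma_nat (nat (padic_res x (Suc k))) :: 'p padic_int) k"
      unfolding G_def by (rule padic_res_mod) simp
    also have "\<dots> = G x k"
      unfolding G_def using padic_res_bounds[of x] padic_res_mod[of k "Suc k" x] padic_res_mod[of k k x]
      by (intro cong) simp
    finally show ?thesis by (rule sym)
  qed
  hence inv: "padic_res (Abs_padic_int (G x) :: 'p padic_int) = G x" for x
    by (intro Abs_padic_int_inverse) blast
  show ?thesis
  proof (rule that)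
    fix k n and x :: "'p padic_int"
    assume "of_nat CARD('p) ^ k dvd x - of_nat n"
    hence x: "padic_res x k = int n mod int CARD('p) ^ k"
      by (simp only: p_power_dvd_diff_iff padic_res_of_nat)
    show "of_nat CARD('p) ^ k dvd (Abs_padic_int (G x) - padic_Gamma_nat n :: 'p padic_int)"
      unfolding p_power_dvd_diff_iff inv by (subst G_def, rule cong) (simp add: x)
  qed
qed

text \<open>Resolves the description in \<open>padic_Gamma\<close>: the function from
  \<open>padic_Gamma_exists\<close> is continuous, and a continuous function with the same values on
  the naturals equals it because the naturals are dense.\<close>

lemma padic_Gamma_approx:
  fixes x :: "'p::prime_card padic_int"
  assumes odd: "odd CARD('p)" and x: "of_nat CARD('p) ^ k dvd x - of_nat n"
  shows "of_nat CARD('p) ^ k dvd padic_Gamma x - padic_Gamma_nat n"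
proof -
  obtain g :: "'p padic_int \<Rightarrow> 'p padic_int"
    where g: "\<And>k x n. of_nat CARD('p) ^ k dvd x - of_nat n \<Longrightarrow>
           of_nat CARD('p) ^ k dvd g x - padic_Gamma_nat n"
    using padic_Gamma_exists[OF odd] by metis
  have "padic_Gamma = g"
    unfolding padic_Gamma_def
  proof (rule the_equality)
    have "of_nat CARD('p) ^ k dvd g x - g y" if xy: "of_nat CARD('p) ^ k dvd x - y" for k x y
    proof -
      obtain n where n: "of_nat CARD('p) ^ k dvd x - of_nat n"
        by (rule padic_approx_nat)
      have "of_nat CARD('p) ^ k dvd (x - of_nat n) - (x - y)"
        using n xy by (rule dvd_diff)
      hence "of_nat CARD('p) ^ k dvd y - of_nat n" by simp
      from dvd_diff[OF g[OF n] g[OF this]] show ?thesis by simp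
    qed
    hence "continuous_on UNIV g" by (rule continuous_on_padicI)
    moreover have "g (of_nat n) = padic_Gamma_nat n" for n
    proof -
      have "g (of_nat n) - padic_Gamma_nat n = 0"
        by (intro padic_int_eq_0I g) simp
      thus ?thesis by simp
    qed
    ultimately show "continuous_on UNIV g \<and> (\<forall>n. g (of_nat n) = padic_Gamma_nat n)" by blast
  next
    fix h :: "'p padic_int \<Rightarrow> 'p padic_int"
    assume h: "continuous_on UNIV h \<and> (\<forall>n. h (of_nat n) = padic_Gamma_nat n)"
    show "h = g"
    proof
      fix x :: "'p padic_int"
      have "\<forall>k. \<exists>n. of_nat CARD('p) ^ k dvd x - of_nat n"
      proof
        fix k
        show "\<exists>n. of_nat CARD('p) ^ k dvd x - of_nat n"
          by (rule padic_approx_nat[of k x]) blast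
      qed
      then obtain a where a: "\<And>k. of_nat CARD('p) ^ k dvd x - of_nat (a k)" by metis
      have sym: "(u :: 'p padic_int) dvd v - w \<longleftrightarrow> u dvd w - v" for u v w
        by (metis dvd_minus_iff minus_diff_eq)
      have "(\<lambda>k. of_nat (a k)) \<longlonglongrightarrow> x"
        using a by (intro padic_tendstoI) (simp only: sym[of _ "of_nat _"])
      hence "(\<lambda>k. h (of_nat (a k))) \<longlonglongrightarrow> h x"
        using h by (intro continuous_on_tendsto_compose[of UNIV h]) auto
      moreover have "(\<lambda>k. h (of_nat (a k))) \<longlonglongrightarrow> g x"
        using a g h by (intro padic_tendstoI) (simp only: sym[of _ "padic_Gamma_nat _"])
      ultimately show "h x = g x" by (rule LIMSEQ_unique)
    qed
  qed
  thus ?thesis using g[OF x] by simp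
qed

lemma padic_Gamma_cong:
  fixes x y :: "'p::prime_card padic_int"
  assumes odd: "odd CARD('p)" and xy: "of_nat CARD('p) ^ k dvd x - y"
  shows "of_nat CARD('p) ^ k dvd padic_Gamma x - padic_Gamma y"
proof -
  obtain n where n: "of_nat CARD('p) ^ k dvd x - of_nat n"
    by (rule padic_approx_nat)
  have "of_nat CARD('p) ^ k dvd (x - of_nat n) - (x - y)"
    using n xy by (rule dvd_diff)
  hence "of_nat CARD('p) ^ k dvd y - of_nat n" by simp
  from dvd_diff[OF padic_Gamma_approx[OF odd n] padic_Gamma_approx[OF odd this]]
  show ?thesis by simp
qed

section \<open>Functional equation of \<open>\<Gamma>\<^sub>p\<close> and unit values\<close>

lemma padic_Gamma_of_nat:
  assumes "odd CARD('p::prime_card)"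
  shows "padic_Gamma (of_nat n :: 'p padic_int) = padic_Gamma_nat n"
proof -
  have "padic_Gamma (of_nat n :: 'p padic_int) - padic_Gamma_nat n = 0"
    using assms by (intro padic_int_eq_0I padic_Gamma_approx) simp_all
  thus ?thesis by simp
qed

lemma padic_Gamma_plus1:
  fixes x :: "'p::prime_card padic_int"
  assumes odd: "odd CARD('p)"
  shows "padic_Gamma (x + 1) = (if of_nat CARD('p) dvd x then - 1 else - x) * padic_Gamma x"
proof -
  let ?p = "of_nat CARD('p) :: 'p padic_int"
  define u where "u = (if ?p dvd x then - 1 else - x)"
  have "?p ^ k dvd padic_Gamma (x + 1) - u * padic_Gamma x" for k
  proof -
    \<comment> \<open>Precision \<open>Suc k\<close> instead of \<open>k\<close> makes
      \<open>n\<close> and \<open>x\<close> congruent modulo p even for \<open>k = 0\<close>, so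
      that both fall under the same case of the functional equation.\<close>
    obtain n where n: "?p ^ Suc k dvd x - of_nat n" by (rule padic_approx_nat)
    define v where "v = (if CARD('p) dvd n then - 1 else - of_nat n :: 'p padic_int)"
    have nk: "?p ^ k dvd x - of_nat n" using n by (rule power_le_dvd) simp
    have n1: "?p dvd x - of_nat n" using power_le_dvd[OF n, of 1] by simp
    have "?p dvd x \<longleftrightarrow> CARD('p) dvd n"
    proof -
      have "?p dvd x \<longleftrightarrow> ?p dvd of_nat n"
        using n1 by (metis dvd_diff_right_iff dvd_diff_left_iff)
      thus ?thesis by (simp only: of_nat_p_dvd_iff)
    qed
    hence uv: "?p ^ k dvd u - v"
      using nk by (auto simp: u_def v_def) (metis dvd_minus_iff minus_diff_eq)
    have "?p ^ k dvd (x + 1) - of_nat (Suc n)" using nk by simp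
    from padic_Gamma_approx[OF odd this]
    have 1: "?p ^ k dvd padic_Gamma (x + 1) - v * padic_Gamma_nat n"
      by (simp add: padic_Gamma_nat_Suc v_def)
    have 2: "?p ^ k dvd u * (padic_Gamma x - padic_Gamma_nat n) + (u - v) * padic_Gamma_nat n"
      using padic_Gamma_approx[OF odd nk] uv by (intro dvd_add dvd_mult dvd_mult2)
    from dvd_diff[OF 1 2] show ?thesis by (simp add: algebra_simps)
  qed
  hence "padic_Gamma (x + 1) - u * padic_Gamma x = 0" by (rule padic_int_eq_0I)
  thus ?thesis by (simp add: u_def)
qed

lemma padic_Gamma_add_nat:
  fixes x :: "'p::prime_card padic_int"
  assumes odd: "odd CARD('p)" and "\<And>i. i < n \<Longrightarrow> \<not> of_nat CARD('p) dvd x + of_nat i"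
  shows "padic_Gamma (x + of_nat n) = (- 1) ^ n * pochhammer x n * padic_Gamma x"
  using assms(2)
proof (induction n)
  case (Suc n)
  have "padic_Gamma (x + of_nat (Suc n)) = - (x + of_nat n) * padic_Gamma (x + of_nat n)"
    using padic_Gamma_plus1[OF odd, of "x + of_nat n"] Suc.prems[of n] by (simp add: add_ac)
  also have "padic_Gamma (x + of_nat n) = (- 1) ^ n * pochhammer x n * padic_Gamma x"
    using Suc by simp
  finally show ?case by (simp add: pochhammer_Suc algebra_simps)
qed simp

lemma p_not_dvd_padic_Gamma:
  fixes x :: "'p::prime_card padic_int"
  assumes odd: "odd CARD('p)"
  shows "\<not> of_nat CARD('p) dvd padic_Gamma x"
proof
  let ?p = "of_nat CARD('p) :: 'p padic_int"
  assume d: "?p dvd padic_Gamma x"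
  obtain n where n: "?p ^ 1 dvd x - of_nat n" by (rule padic_approx_nat)
  from padic_Gamma_approx[OF odd n] d have "?p dvd padic_Gamma_nat n"
    by (simp add: dvd_diff_right_iff)
  moreover have "\<not> ?p dvd padic_Gamma_nat n" for n
  proof (induction n)
    case 0
    show ?case using prime_elem_not_unit[OF prime_elem_p[where 'p='p]] by simp
  next
    case (Suc n)
    have "\<not> ?p dvd (if CARD('p) dvd n then - 1 else - of_nat n)"
      using prime_elem_not_unit[OF prime_elem_p[where 'p='p]] by (simp add: of_nat_p_dvd_iff)
    thus ?case
      using Suc by (simp only: padic_Gamma_nat_Suc prime_elem_dvd_mult_iff[OF prime_elem_p] simp_thms)
  qed
  ultimately show False by blast
qed

section \<open>Affine functions modulo the square of p\<close>

text \<open>A first-order expansion. The factor p of the linear part is the one in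
  \<open>-a + p x\<close> and \<open>-b + p y\<close>; it makes products of linear parts vanish
  modulo \<open>p ^ 2\<close>, whence the stability under multiplication.\<close>

definition affine_mod_p2 ::
    "('p::prime_card padic_int \<Rightarrow> 'p padic_int \<Rightarrow> 'p padic_int) \<Rightarrow> bool" where
  "affine_mod_p2 f \<longleftrightarrow>
     (\<exists>c A B. \<forall>x y. of_nat CARD('p) ^ 2 dvd f x y - (c + of_nat CARD('p) * (A * x + B * y)))"

lemma affine_mod_p2_const: "affine_mod_p2 (\<lambda>x y. c)"
  unfolding affine_mod_p2_def by (rule exI[of _ c], rule exI[of _ 0], rule exI[of _ 0]) simp

lemma affine_mod_p2_linear:
  assumes "\<And>x y. f x y = c + of_nat CARD('p::prime_card) * (A * x + B * y)"
  shows "affine_mod_p2 (f :: 'p padic_int \<Rightarrow> 'p padic_int \<Rightarrow> 'p padic_int)"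
  unfolding affine_mod_p2_def assms
  by (rule exI[of _ c], rule exI[of _ A], rule exI[of _ B]) simp

lemma affine_mod_p2_add:
  assumes "affine_mod_p2 f" "affine_mod_p2 g"
  shows "affine_mod_p2 (\<lambda>x y. f x y + g x y :: 'p::prime_card padic_int)"
proof -
  let ?p = "of_nat CARD('p) :: 'p padic_int"
  obtain c A B where f: "\<And>x y. ?p ^ 2 dvd f x y - (c + ?p * (A * x + B * y))"
    using assms(1) unfolding affine_mod_p2_def by blast
  obtain d C D where g: "\<And>x y. ?p ^ 2 dvd g x y - (d + ?p * (C * x + D * y))"
    using assms(2) unfolding affine_mod_p2_def by blast
  show ?thesis unfolding affine_mod_p2_def
  proof (intro exI allI)
    fix x y
    from dvd_add[OF f[of x y] g[of x y]]
    show "?p ^ 2 dvd f x y + g x y - ((c + d) + ?p * ((A + C) * x + (B + D) * y))"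
      by (simp add: algebra_simps)
  qed
qed

lemma affine_mod_p2_mult:
  assumes "affine_mod_p2 f" "affine_mod_p2 g"
  shows "affine_mod_p2 (\<lambda>x y. f x y * g x y :: 'p::prime_card padic_int)"
proof -
  let ?p = "of_nat CARD('p) :: 'p padic_int"
  obtain c A B where f: "\<And>x y. ?p ^ 2 dvd f x y - (c + ?p * (A * x + B * y))"
    using assms(1) unfolding affine_mod_p2_def by blast
  obtain d C D where g: "\<And>x y. ?p ^ 2 dvd g x y - (d + ?p * (C * x + D * y))"
    using assms(2) unfolding affine_mod_p2_def by blast
  show ?thesis unfolding affine_mod_p2_def
  proof (intro exI allI)
    fix x y
    define u v where "u = A * x + B * y" and "v = C * x + D * y"
    have "?p ^ 2 dvd (f x y - (c + ?p * u)) * g x y + (c + ?p * u) * (g x y - (d + ?p * v))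
                      + ?p ^ 2 * (u * v)"
      unfolding u_def v_def using f[of x y] g[of x y] by (intro dvd_add dvd_mult dvd_mult2 dvd_refl)
    also have "\<dots> = f x y * g x y - (c * d + ?p * (d * u + c * v))"
      by (simp add: algebra_simps power2_eq_square)
    also have "d * u + c * v = (d * A + c * C) * x + (d * B + c * D) * y"
      by (simp add: u_def v_def algebra_simps)
    finally show "?p ^ 2 dvd f x y * g x y - (c * d + ?p * ((d * A + c * C) * x + (d * B + c * D) * y))" .
  qed
qed

lemma affine_mod_p2_sum:
  assumes "\<And>k. k \<in> S \<Longrightarrow> affine_mod_p2 (f k)"
  shows "affine_mod_p2 (\<lambda>x y. \<Sum>k\<in>S. f k x y)"
  using assms
  by (induction S rule: infinite_finite_induct)
     (auto intro: affine_mod_p2_const affine_mod_p2_add)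

lemma affine_mod_p2_pochhammer:
  assumes "affine_mod_p2 f"
  shows "affine_mod_p2 (\<lambda>x y. pochhammer (f x y) k)"
proof (induction k)
  case 0
  show ?case by (simp add: affine_mod_p2_const)
next
  case (Suc k)
  have "affine_mod_p2 (\<lambda>x y. pochhammer (f x y) k * (f x y + of_nat k))"
    by (intro affine_mod_p2_mult Suc affine_mod_p2_add assms affine_mod_p2_const)
  thus ?case by (simp only: pochhammer_Suc)
qed

text \<open>Modulo \<open>p ^ 2\<close> an affine function satisfies
  \<open>f x y = f x 0 + f 0 y - f 0 0\<close>, so its values on the two axes determine it.\<close>

lemma affine_mod_p2_vanish:
  fixes f :: "'p::prime_card padic_int \<Rightarrow> 'p padic_int \<Rightarrow> 'p padic_int"
  assumes "affine_mod_p2 f"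
    and fx: "\<And>x. of_nat CARD('p) ^ 2 dvd f x 0" and fy: "\<And>y. of_nat CARD('p) ^ 2 dvd f 0 y"
  shows "of_nat CARD('p) ^ 2 dvd f x y"
proof -
  let ?p = "of_nat CARD('p) :: 'p padic_int"
  obtain c A B where f: "\<And>x y. ?p ^ 2 dvd f x y - (c + ?p * (A * x + B * y))"
    using assms(1) unfolding affine_mod_p2_def by blast
  have "?p ^ 2 dvd (f x y - (c + ?p * (A * x + B * y))) - (f x 0 - (c + ?p * (A * x + B * 0)))
     - (f 0 y - (c + ?p * (A * 0 + B * y))) + (f 0 0 - (c + ?p * (A * 0 + B * 0)))
     + f x 0 + f 0 y - f 0 0"
    by (intro dvd_add dvd_diff f fx fy)
  thus ?thesis by (simp add: algebra_simps)
qed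

section \<open>First-order expansion of \<open>\<Gamma>\<^sub>p\<close> modulo
  \<open>p\<^sup>2\<close>\<close>

lemma dvd_prod_diff:
  fixes f g :: "'b \<Rightarrow> 'a::comm_ring_1"
  assumes "\<And>i. i \<in> S \<Longrightarrow> d dvd f i - g i"
  shows "d dvd prod f S - prod g S"
  using assms
proof (induction S rule: infinite_finite_induct)
  case (insert i S)
  have "d dvd (f i - g i) * prod f S + g i * (prod f S - prod g S)"
    using insert by (intro dvd_add dvd_mult dvd_mult2) auto
  thus ?case using insert.hyps by (simp add: algebra_simps)
qed auto

lemma prod_lessThan_double:
  "(\<Prod>i<2 * h. f i :: 'a::comm_monoid_mult) = (\<Prod>i<h. f i * f (2 * h - Suc i))"
proof -
  have "(\<Prod>i<h + n. f i) = (\<Prod>i<h. f i) * (\<Prod>i<n. f (h + i))" for n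
    by (induction n) (auto simp: mult_ac)
  from this[of h] have "(\<Prod>i<2 * h. f i) = (\<Prod>i<h. f i) * (\<Prod>i<h. f (h + i))"
    by (simp add: mult_2)
  also have "(\<Prod>i<h. f (h + i)) = (\<Prod>i<h. f (h + (h - Suc i)))"
    by (rule prod.nat_diff_reindex[symmetric])
  also have "\<dots> = (\<Prod>i<h. f (2 * h - Suc i))"
    by (simp add: mult_2)
  finally show ?thesis by (simp add: prod.distrib)
qed

text \<open>Pairing the factors \<open>px + j\<close> and \<open>px + (p - j)\<close>, whose product is \<open>j (p - j)\<close> modulo
  \<open>p\<^sup>2\<close>, replaces the vanishing of the harmonic sum modulo \<open>p\<close>.\<close>
lemma pochhammer_p_shift:
  fixes x :: "'p::prime_card padic_int"
  assumes odd: "odd CARD('p)"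
  shows "of_nat CARD('p) ^ 2 dvd
           pochhammer (of_nat CARD('p) * x + 1) (CARD('p) - 1) - fact (CARD('p) - 1)"
proof -
  let ?p = "of_nat CARD('p) :: 'p padic_int"
  obtain h where h: "CARD('p) = 2 * h + 1" using odd by (elim oddE)
  have p: "?p = 2 * of_nat h + 1" unfolding h by simp
  define f where "f x i = ?p * x + 1 + of_nat i" for x and i :: nat
  have poch: "pochhammer (?p * x + 1) (CARD('p) - 1) = (\<Prod>i<h. f x i * f x (2 * h - Suc i))" for x
    using prod_lessThan_double[of "f x" h]
    by (simp only: pochhammer_prod f_def h lessThan_atLeast0 add_diff_cancel_right')
  have "?p ^ 2 dvd f x i * f x (2 * h - Suc i) - f 0 i * f 0 (2 * h - Suc i)" if "i < h" for i
  proof -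
    have i: "of_nat (2 * h - Suc i) = ?p - 2 - of_nat i"
      using that by (simp add: of_nat_diff p)
    have "f x i * f x (2 * h - Suc i) - f 0 i * f 0 (2 * h - Suc i) = ?p ^ 2 * (x * x + x)"
      unfolding f_def i by (simp add: algebra_simps power2_eq_square)
    thus ?thesis by simp
  qed
  hence "?p ^ 2 dvd pochhammer (?p * x + 1) (CARD('p) - 1) - pochhammer (?p * 0 + 1) (CARD('p) - 1)"
    unfolding poch by (intro dvd_prod_diff) auto
  thus ?thesis by (simp add: pochhammer_fact)
qed

lemma padic_Gamma_0: "odd CARD('p::prime_card) \<Longrightarrow> padic_Gamma (0 :: 'p padic_int) = 1"
  using padic_Gamma_of_nat[of 0, where 'p='p] by simp

text \<open>Raising \<open>t\<close> by 1 multiplies the value at \<open>p t\<close> by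
  \<open>-(p-1)!\<close> modulo \<open>p ^ 2\<close>, by \<open>pochhammer_p_shift\<close>. Writing
  this constant as \<open>1 + p A\<close> gives \<open>(1 + p A) ^ m\<close>, that is
  \<open>1 + p A m\<close>, at \<open>t = m\<close>; approximation by naturals covers the other
  \<open>t\<close>.\<close>

lemma padic_Gamma_p_mult:
  assumes odd: "odd CARD('p::prime_card)"
  obtains A :: "'p::prime_card padic_int" where
    "\<And>t. of_nat CARD('p) ^ 2 dvd padic_Gamma (of_nat CARD('p) * t) - (1 + of_nat CARD('p) * (A * t))"
proof -
  let ?p = "of_nat CARD('p) :: 'p padic_int"
  have p1: "CARD('p) > 1" using prime_gt_1_nat[OF prime_card[where 'a='p]] .
  have "int CARD('p) dvd fact (CARD('p) - 1) + 1"
    using wilson_theorem[OF prime_card[where 'a='p]] by (simp add: cong_iff_dvd_diff)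
  hence "?p dvd of_int (fact (CARD('p) - 1) + 1)" by (simp only: of_int_p_dvd_iff)
  hence "?p dvd fact (CARD('p) - 1) + 1" by simp
  then obtain B where "fact (CARD('p) - 1) + 1 = ?p * B" by blast
  \<comment> \<open>By Wilson's theorem \<open>B\<close> is integral; it is the Wilson
    quotient.\<close>
  define A where "A = - B"
  have A: "- fact (CARD('p) - 1) = 1 + ?p * A"
    using \<open>fact (CARD('p) - 1) + 1 = ?p * B\<close> by (simp add: A_def algebra_simps eq_diff_eq minus_equation_iff)
  have step: "?p ^ 2 dvd padic_Gamma (?p * (t + 1)) - (1 + ?p * A) * padic_Gamma (?p * t)" for t
  proof -
    have n: "\<not> ?p dvd ?p * t + 1 + of_nat i" if "i < CARD('p) - 1" for i
    proof
      assume "?p dvd ?p * t + 1 + of_nat i"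
      hence "?p dvd ?p * t + of_nat (Suc i)" by (simp add: add_ac)
      hence "?p dvd of_nat (Suc i)" by (simp only: dvd_add_right_iff dvd_triv_left)
      hence "CARD('p) dvd Suc i" by (simp only: of_nat_p_dvd_iff)
      thus False using that by (auto dest: dvd_imp_le)
    qed
    have "padic_Gamma (?p * (t + 1)) = padic_Gamma (?p * t + 1 + of_nat (CARD('p) - 1))"
      using p1 by (simp add: of_nat_diff algebra_simps)
    also have "\<dots> = (- 1) ^ (CARD('p) - 1) * pochhammer (?p * t + 1) (CARD('p) - 1)
                      * padic_Gamma (?p * t + 1)"
      by (rule padic_Gamma_add_nat[OF odd n])
    \<comment> \<open>The sign \<open>(-1) ^ (p - 1)\<close> is 1. The minus sign comes from the
      step from \<open>p t\<close> to \<open>p t + 1\<close>, where the functional equation has the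
      factor -1.\<close>
    also have "\<dots> = - (pochhammer (?p * t + 1) (CARD('p) - 1) * padic_Gamma (?p * t))"
      using padic_Gamma_plus1[OF odd, of "?p * t"] odd p1 by simp
    finally have "padic_Gamma (?p * (t + 1)) - (1 + ?p * A) * padic_Gamma (?p * t) =
      (pochhammer (?p * t + 1) (CARD('p) - 1) - fact (CARD('p) - 1)) * - padic_Gamma (?p * t)"
      unfolding A[symmetric] by (simp add: algebra_simps)
    thus ?thesis using pochhammer_p_shift[OF odd, of t] by simp
  qed
  have nat: "?p ^ 2 dvd padic_Gamma (?p * of_nat m) - (1 + ?p * (A * of_nat m))" for m
  proof (induction m)
    case 0
    show ?case using padic_Gamma_0[OF odd] by simp
  next
    case (Suc m)
    have "?p ^ 2 dvd (padic_Gamma (?p * (of_nat m + 1)) - (1 + ?p * A) * padic_Gamma (?p * of_nat m))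
        + (1 + ?p * A) * (padic_Gamma (?p * of_nat m) - (1 + ?p * (A * of_nat m)))
        + ?p ^ 2 * (A * A * of_nat m)"
      using Suc step by (intro dvd_add dvd_mult dvd_triv_left)
    thus ?case by (simp add: algebra_simps power2_eq_square)
  qed
  show ?thesis
  proof (rule that)
    fix t
    \<comment> \<open>Knowing \<open>t\<close> modulo p suffices: the argument \<open>p t\<close>
      then changes only by a multiple of \<open>p ^ 2\<close>.\<close>
    obtain m where m: "?p ^ 1 dvd t - of_nat m" by (rule padic_approx_nat)
    then obtain z where z: "t = of_nat m + ?p * z" by (metis dvdE diff_eq_eq add.commute power_one_right)
    have "?p * t - ?p * of_nat m = ?p ^ 2 * z" by (simp add: z algebra_simps power2_eq_square)
    hence "?p ^ 2 dvd padic_Gamma (?p * t) - padic_Gamma (?p * of_nat m)"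
      by (intro padic_Gamma_cong[OF odd]) simp
    hence "?p ^ 2 dvd (padic_Gamma (?p * t) - padic_Gamma (?p * of_nat m)) +
       (padic_Gamma (?p * of_nat m) - (1 + ?p * (A * of_nat m))) - ?p ^ 2 * (A * z)"
      by (rule dvd_diff[OF dvd_add[OF _ nat] dvd_triv_left])
    also have "\<dots> = padic_Gamma (?p * t) - (1 + ?p * (A * t))"
      by (simp add: z algebra_simps power2_eq_square)
    finally show "?p ^ 2 dvd padic_Gamma (?p * t) - (1 + ?p * (A * t))" .
  qed
qed

text \<open>The functional equation carries the expansion from base point 0 to every natural base
  point \<open>r\<close>, multiplying it by -1 or by the affine factor \<open>-(r + p t)\<close>. A
  general \<open>w = r + p z\<close> is reached by replacing \<open>t\<close> with
  \<open>z + t\<close>.\<close>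

lemma padic_Gamma_affine:
  fixes w :: "'p::prime_card padic_int"
  assumes odd: "odd CARD('p)"
  obtains c A where
    "\<And>t. of_nat CARD('p) ^ 2 dvd padic_Gamma (w + of_nat CARD('p) * t) - (c + of_nat CARD('p) * (A * t))"
proof -
  let ?p = "of_nat CARD('p) :: 'p padic_int"
  have nat: "\<exists>c A. \<forall>t. ?p ^ 2 dvd padic_Gamma (of_nat r + ?p * t) - (c + ?p * (A * t))" for r
  proof (induction r)
    case 0
    obtain A where "\<And>t. ?p ^ 2 dvd padic_Gamma (?p * t) - (1 + ?p * (A * t))"
      using padic_Gamma_p_mult[OF odd] by metis
    hence "\<forall>t. ?p ^ 2 dvd padic_Gamma (of_nat 0 + ?p * t) - (1 + ?p * (A * t))" by simp
    thus ?case by blast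
  next
    case (Suc r)
    then obtain c A where cA: "\<And>t. ?p ^ 2 dvd padic_Gamma (of_nat r + ?p * t) - (c + ?p * (A * t))"
      by blast
    have eq: "padic_Gamma (of_nat (Suc r) + ?p * t) = (if CARD('p) dvd r then - 1 else - (of_nat r + ?p * t))
               * padic_Gamma (of_nat r + ?p * t)" for t
      using padic_Gamma_plus1[OF odd, of "of_nat r + ?p * t"]
      by (simp add: add_ac dvd_add_left_iff of_nat_p_dvd_iff)
    show ?case
    proof (cases "CARD('p) dvd r")
      case True
      have "?p ^ 2 dvd padic_Gamma (of_nat (Suc r) + ?p * t) - (- c + ?p * (- A * t))" for t
      proof -
        have "padic_Gamma (of_nat (Suc r) + ?p * t) - (- c + ?p * (- A * t)) =
              - (padic_Gamma (of_nat r + ?p * t) - (c + ?p * (A * t)))"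
          unfolding eq using True by simp
        thus ?thesis using cA[of t] by (simp only: dvd_minus_iff)
      qed
      thus ?thesis by blast
    next
      case False
      have "?p ^ 2 dvd padic_Gamma (of_nat (Suc r) + ?p * t)
              - (- of_nat r * c + ?p * ((- of_nat r * A - c) * t))" for t
      proof -
        have "?p ^ 2 dvd - (of_nat r + ?p * t) * (padic_Gamma (of_nat r + ?p * t) - (c + ?p * (A * t)))
                - ?p ^ 2 * (A * t * t)"
          by (intro dvd_diff dvd_mult[OF cA] dvd_triv_left)
        also have "\<dots> = padic_Gamma (of_nat (Suc r) + ?p * t)
              - (- of_nat r * c + ?p * ((- of_nat r * A - c) * t))"
          unfolding eq using False by (simp add: algebra_simps power2_eq_square)
        finally show ?thesis .
      qed
      thus ?thesis by blast
    qed
  qed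
  obtain r where "?p ^ 1 dvd w - of_nat r" by (rule padic_approx_nat)
  then obtain z where z: "w = of_nat r + ?p * z" by (metis dvdE diff_eq_eq add.commute power_one_right)
  obtain c A where cA: "\<And>t. ?p ^ 2 dvd padic_Gamma (of_nat r + ?p * t) - (c + ?p * (A * t))"
    using nat by blast
  show ?thesis
  proof (rule that)
    fix t
    show "?p ^ 2 dvd padic_Gamma (w + ?p * t) - ((c + ?p * (A * z)) + ?p * (A * t))"
      using cA[of "z + t"] by (simp add: z algebra_simps)
  qed
qed

lemma affine_mod_p2_padic_Gamma:
  fixes f :: "'p::prime_card padic_int \<Rightarrow> 'p padic_int \<Rightarrow> 'p padic_int"
  assumes odd: "odd CARD('p)" and f: "\<And>x y. f x y = w + of_nat CARD('p) * (i * x + j * y)"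
  shows "affine_mod_p2 (\<lambda>x y. padic_Gamma (f x y))"
proof -
  let ?p = "of_nat CARD('p) :: 'p padic_int"
  obtain c A where cA: "\<And>t. ?p ^ 2 dvd padic_Gamma (w + ?p * t) - (c + ?p * (A * t))"
    using padic_Gamma_affine[OF odd] by metis
  show ?thesis unfolding affine_mod_p2_def f
  proof (intro exI allI)
    fix x y
    show "?p ^ 2 dvd padic_Gamma (w + ?p * (i * x + j * y)) - (c + ?p * ((A * i) * x + (A * j) * y))"
      using cA[of "i * x + j * y"] by (simp add: algebra_simps)
  qed
qed

section \<open>The truncated series\<close>

lemma to_fract_of_nat [simp]: "to_fract (of_nat n) = of_nat n"
  by (induction n) auto

lemma to_fract_pochhammer [simp]: "to_fract (pochhammer x k) = pochhammer (to_fract x) k"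
  by (induction k) (auto simp: pochhammer_Suc)

lemma to_fract_power [simp]: "to_fract (x ^ n) = to_fract x ^ n"
  by (induction n) auto

lemma to_fract_fact [simp]: "to_fract (fact n) = (fact n :: 'a::{idom,ring_char_0} fract)"
proof -
  have "to_fract (of_nat (fact n) :: 'a) = of_nat (fact n)" by (rule to_fract_of_nat)
  thus ?thesis by simp
qed

text \<open>\<open>I k\<close> stands for the inverse in \<open>\<int>\<^sub>p\<close> of \<open>(k!)\<^sup>2 (g)\<^sub>k\<close>, which is a unit for \<open>k \<le> c = \<langle>-g\<rangle>\<^sub>p\<close>.\<close>
definition saal_sum ::
    "(nat \<Rightarrow> 'a) \<Rightarrow> nat \<Rightarrow> 'a \<Rightarrow> 'a \<Rightarrow> 'a \<Rightarrow> 'a::comm_ring_1" where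
  "saal_sum I c g a b =
     (\<Sum>k\<le>c. pochhammer a k * pochhammer b k * pochhammer (g - a - b) k * I k)"

lemma saal_sum_commute: "saal_sum I c g a b = saal_sum I c g b a"
  unfolding saal_sum_def by (intro sum.cong) (auto simp: mult_ac algebra_simps)

text \<open>\<open>saalschutz_lower_one\<close> needs a field, whereas \<open>saal_sum\<close> uses
  the inverses \<open>I k\<close> in the ring. The proof therefore passes to the field of fractions
  and returns by injectivity of \<open>to_fract\<close>.\<close>

lemma saal_sum_eval:
  fixes b g :: "'a::{idom,ring_char_0}"
  assumes I: "\<forall>k\<le>c. I k * (fact k ^ 2 * pochhammer g k) = 1" and n: "n \<le> c"
  shows "saal_sum I c g (- of_nat n) b * (fact n * pochhammer g n) =
           pochhammer (1 - b) n * pochhammer (g - b) n"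
proof -
  have nz: "pochhammer (to_fract g) k \<noteq> 0" if "k \<le> c" for k
    using I[rule_format, OF that] by (auto simp flip: to_fract_pochhammer)
  have trm: "to_fract (pochhammer (- of_nat n) k * pochhammer b k * pochhammer (g - - of_nat n - b) k * I k)
          = saal_term (to_fract b) (to_fract g) n k" if "k \<le> c" for k
  proof -
    have "to_fract (I k) * (fact k ^ 2 * pochhammer (to_fract g) k) = 1"
      using arg_cong[OF I[rule_format, OF that], of to_fract] by simp
    hence "to_fract (I k) = 1 / (fact k ^ 2 * pochhammer (to_fract g) k)"
      by (simp add: eq_divide_eq nz that)
    moreover have "g - - of_nat n - b = g - b + of_nat n" by simp
    ultimately show ?thesis by (simp only: saal_term_def) simp
  qed
  have "to_fract (saal_sum I c g (- of_nat n) b) = (\<Sum>k\<le>c. saal_term (to_fract b) (to_fract g) n k)"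
    unfolding saal_sum_def to_fract_sum by (intro sum.cong refl trm) auto
  \<comment> \<open>The terms with \<open>n < k \<le> c\<close> contain the symbol
    \<open>(-n)_k = 0\<close>.\<close>
  also have "\<dots> = (\<Sum>k\<le>n. saal_term (to_fract b) (to_fract g) n k)"
    using n by (intro sum.mono_neutral_right) (auto simp: saal_term_def pochhammer_of_nat_eq_0_iff)
  also have "\<dots> = pochhammer (1 - to_fract b) n * pochhammer (to_fract g - to_fract b) n /
                     (fact n * pochhammer (to_fract g) n)"
    using nz[OF n] by (rule saalschutz_lower_one)
  finally have "to_fract (saal_sum I c g (- of_nat n) b * (fact n * pochhammer g n)) =
                  to_fract (pochhammer (1 - b) n * pochhammer (g - b) n)"
    using nz[OF n] by simp
  thus ?thesis by (simp only: to_fract_eq_iff)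
qed

section \<open>Divisibility by p and reduction of the truncated series\<close>

lemma p_dvd_add_of_int_iff:
  fixes x :: "'p::prime_card padic_int"
  assumes "of_nat CARD('p) dvd x + of_int a"
  shows "of_nat CARD('p) dvd x + of_int j \<longleftrightarrow> int CARD('p) dvd j - a"
proof -
  have "x + of_int j = (x + of_int a) + of_int (j - a)" by simp
  hence "of_nat CARD('p) dvd x + of_int j \<longleftrightarrow> (of_nat CARD('p) :: 'p padic_int) dvd of_int (j - a)"
    using assms by (simp only: dvd_add_right_iff)
  thus ?thesis by (simp only: of_int_p_dvd_iff)
qed

lemma p_not_dvd_add_nat:
  fixes x :: "'p::prime_card padic_int"
  assumes "of_nat CARD('p) dvd x + of_int a" "int i < a" "a < int CARD('p) + int i"
  shows "\<not> of_nat CARD('p) dvd x + of_nat i"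
proof
  assume "of_nat CARD('p) dvd x + of_nat i"
  hence "int CARD('p) dvd int i - a"
    using p_dvd_add_of_int_iff[OF assms(1), of "int i"] by simp
  hence "int CARD('p) dvd a - int i" by (simp add: dvd_diff_commute)
  from zdvd_imp_le[OF this] show False using assms by simp
qed

lemma p_dvd_pochhammer:
  fixes x :: "'p::prime_card padic_int"
  assumes "of_nat CARD('p) dvd x + of_int a" "0 \<le> a" "a < int k"
  shows "of_nat CARD('p) dvd pochhammer x k"
proof -
  have "of_nat CARD('p) dvd x + of_nat (nat a)" using assms by simp
  moreover have "x + of_nat (nat a) dvd pochhammer x k"
    unfolding pochhammer_prod using assms by (intro dvd_prodI) auto
  ultimately show ?thesis by (rule dvd_trans)
qed

lemma p_not_dvd_pochhammer:
  fixes x :: "'p::prime_card padic_int"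
  assumes "of_nat CARD('p) dvd x + of_int a" "int k \<le> a" "a < int CARD('p)"
  shows "\<not> of_nat CARD('p) dvd pochhammer x k"
  using assms(2)
proof (induction k)
  case 0
  show ?case using prime_elem_not_unit[OF prime_elem_p[where 'p='p]] by simp
next
  case (Suc k)
  have "\<not> of_nat CARD('p) dvd x + of_nat k"
    using assms Suc.prems by (intro p_not_dvd_add_nat[OF assms(1)]) auto
  thus ?case
    using Suc by (simp add: pochhammer_Suc prime_elem_dvd_mult_iff[OF prime_elem_p])
qed

lemma p_not_dvd_fact:
  assumes "k < CARD('p::prime_card)"
  shows "\<not> of_nat CARD('p) dvd (fact k :: 'p padic_int)"
proof -
  have "\<not> CARD('p) dvd fact k"
    using assms prime_dvd_fact_iff[OF prime_card[where 'a='p]] by simp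
  hence "\<not> of_nat CARD('p) dvd (of_nat (fact k) :: 'p padic_int)" unfolding of_nat_p_dvd_iff .
  thus ?thesis by simp
qed

text \<open>\<open>V\<close> is a unit or p times a unit, hence divides p. With
  \<open>V * e = p\<close> and \<open>N = p ^ 3 * w\<close> the quotient is
  \<open>p ^ 2 * (e * w)\<close>.\<close>

lemma divide_p_cubed:
  fixes N V :: "'p::prime_card padic_int"
  assumes V: "\<not> of_nat CARD('p) ^ 2 dvd V" and N: "of_nat CARD('p) ^ 3 dvd N"
  obtains z where "to_fract N / to_fract V = to_fract (of_nat CARD('p) ^ 2 * z)"
proof -
  let ?p = "of_nat CARD('p) :: 'p padic_int"
  have "V \<noteq> 0" using V by auto
  obtain w where w: "N = ?p ^ 3 * w" using N by blast
  obtain e where e: "V * e = ?p"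
  proof (cases "?p dvd V")
    case False
    then obtain y where "V * y = 1" by (rule padic_unit)
    hence "V * (y * ?p) = ?p" by (simp add: mult.assoc[symmetric])
    thus ?thesis by (rule that)
  next
    case True
    then obtain u where u: "V = ?p * u" by blast
    hence "\<not> ?p dvd u" using V by (auto simp: power2_eq_square)
    then obtain y where "u * y = 1" by (rule padic_unit)
    hence "V * y = ?p" by (simp add: u mult.assoc)
    thus ?thesis by (rule that)
  qed
  have "N = ?p ^ 2 * (e * w) * V"
    by (simp add: w power3_eq_cube power2_eq_square e[symmetric] mult_ac)
  hence "to_fract N = to_fract (?p ^ 2 * (e * w)) * to_fract V" by (simp only: to_fract_mult)
  hence "to_fract N / to_fract V = to_fract (?p ^ 2 * (e * w))"
    using \<open>V \<noteq> 0\<close> by (simp add: divide_eq_eq)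
  thus ?thesis by (rule that)
qed

text \<open>The terms with \<open>k > c\<close> have three factors \<open>p\<close> in the numerator and at most one in the
  denominator.\<close>
lemma trunc_hypergeom_eq_saal_sum:
  fixes \<alpha> \<beta> \<gamma> :: "'p::prime_card padic_int"
  assumes "of_nat CARD('p) dvd \<alpha> + of_int a" "0 \<le> a" "a \<le> int c"
    and "of_nat CARD('p) dvd \<beta> + of_int b" "0 \<le> b" "b \<le> int c"
    and "of_nat CARD('p) dvd \<gamma> - \<alpha> - \<beta> + of_int d" "0 \<le> d" "d \<le> int c"
    and c: "c < CARD('p)"
    and I: "\<forall>k\<le>c. I k * (fact k ^ 2 * pochhammer \<gamma> k) = 1"
    and \<gamma>: "\<not> of_nat CARD('p) ^ 2 dvd pochhammer \<gamma> (CARD('p) - 1)"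
  obtains z where
    "trunc_hypergeom [to_fract \<alpha>, to_fract \<beta>, to_fract (\<gamma> - \<alpha> - \<beta>)] [1, to_fract \<gamma>] 1 (CARD('p) - 1) =
       to_fract (saal_sum I c \<gamma> \<alpha> \<beta> + of_nat CARD('p) ^ 2 * z)"
proof -
  let ?p = "of_nat CARD('p) :: 'p padic_int"
  define T where "T k = pochhammer \<alpha> k * pochhammer \<beta> k * pochhammer (\<gamma> - \<alpha> - \<beta>) k" for k
  define S where "S k = to_fract (T k) / (fact k ^ 2 * pochhammer (to_fract \<gamma>) k)" for k
  have S: "trunc_hypergeom [to_fract \<alpha>, to_fract \<beta>, to_fract (\<gamma> - \<alpha> - \<beta>)] [1, to_fract \<gamma>] 1 n
             = (\<Sum>k\<le>n. S k)" for n
    unfolding trunc_hypergeom_def S_def T_def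
    by (simp add: atLeast0AtMost pochhammer_fact[symmetric] power2_eq_square mult_ac)
  have low: "S k = to_fract (T k * I k)" if "k \<le> c" for k
  proof -
    have "to_fract (I k) * (fact k ^ 2 * pochhammer (to_fract \<gamma>) k) = 1"
      using arg_cong[OF I[rule_format, OF that], of to_fract] by simp
    hence "to_fract (I k) = 1 / (fact k ^ 2 * pochhammer (to_fract \<gamma>) k)"
      by (metis mult_zero_right nonzero_eq_divide_eq zero_neq_one)
    thus ?thesis by (simp add: S_def)
  qed
  have high: "\<exists>z. S k = to_fract (?p ^ 2 * z)" if "k \<in> {c<..CARD('p) - 1}" for k
  proof -
    have k: "k > c" "k \<le> CARD('p) - 1" using that by auto
    \<comment> \<open>\<open>a\<close>, \<open>b\<close> and \<open>d\<close> are all below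
      \<open>k\<close>, so each Pochhammer symbol contains a factor divisible by p.\<close>
    have "?p * ?p * ?p dvd T k"
      unfolding T_def using assms(2,3,5,6,8,9) k
      by (intro mult_dvd_mono p_dvd_pochhammer[OF assms(1)] p_dvd_pochhammer[OF assms(4)]
          p_dvd_pochhammer[OF assms(7)]) auto
    moreover have "k < CARD('p)" using k c by linarith
    from padic_unit[OF p_not_dvd_fact[OF this]] obtain f :: "'p padic_int" where f: "fact k * f = 1" .
    ultimately have "?p ^ 3 dvd T k * f ^ 2" by (simp add: power3_eq_cube)
    \<comment> \<open>\<open>(\<gamma>)_k\<close> divides \<open>(\<gamma>)_(p-1)\<close>, so the
      hypothesis leaves it at most one factor p.\<close>
    moreover have "\<not> ?p ^ 2 dvd pochhammer \<gamma> k"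
    proof
      assume "?p ^ 2 dvd pochhammer \<gamma> k"
      moreover have "pochhammer \<gamma> k dvd pochhammer \<gamma> (CARD('p) - 1)"
        using pochhammer_product[OF k(2), of \<gamma>] by simp
      ultimately show False using \<gamma> dvd_trans by blast
    qed
    ultimately obtain z where z: "to_fract (T k * f ^ 2) / to_fract (pochhammer \<gamma> k) = to_fract (?p ^ 2 * z)"
      by (metis divide_p_cubed)
    have "to_fract f = 1 / fact k"
      using arg_cong[OF f, of to_fract] by (simp add: eq_divide_eq mult.commute)
    hence "S k = to_fract (T k * f ^ 2) / to_fract (pochhammer \<gamma> k)"
      by (simp add: S_def power_one_over)
    thus ?thesis using z by metis
  qed
  then obtain z where z: "\<And>k. k \<in> {c<..CARD('p) - 1} \<Longrightarrow> S k = to_fract (?p ^ 2 * z k)" by metis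
  have "{..CARD('p) - 1} = {..c} \<union> {c<..CARD('p) - 1}" using c by auto
  hence "(\<Sum>k\<le>CARD('p) - 1. S k) = (\<Sum>k\<le>c. S k) + (\<Sum>k\<in>{c<..CARD('p) - 1}. S k)"
    by (simp only: sum.union_disjoint[OF finite_atMost finite_greaterThanAtMost] ivl_disj_int)
  also have "(\<Sum>k\<le>c. S k) = to_fract (saal_sum I c \<gamma> \<alpha> \<beta>)"
    unfolding saal_sum_def to_fract_sum T_def[symmetric] by (intro sum.cong) (auto simp: low)
  also have "(\<Sum>k\<in>{c<..CARD('p) - 1}. S k) = to_fract (?p ^ 2 * (\<Sum>k\<in>{c<..CARD('p) - 1}. z k))"
    unfolding sum_distrib_left to_fract_sum by (intro sum.cong refl z)
  finally show ?thesis
    unfolding S[symmetric] to_fract_add[symmetric] by (rule that)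
qed

section \<open>The Gamma quotient\<close>

definition Gamma_num :: "'p::prime_card padic_int \<Rightarrow> 'p padic_int \<Rightarrow> 'p padic_int \<Rightarrow> 'p padic_int" where
  "Gamma_num g a b = padic_Gamma (1 + a - g) * padic_Gamma (1 + b - g) * padic_Gamma (1 - a - b)"

text \<open>Kept apart from \<open>Gamma_num\<close> so that only sums and products of affine
  functions occur.\<close>

definition Gamma_den :: "'p::prime_card padic_int \<Rightarrow> 'p padic_int \<Rightarrow> 'p padic_int \<Rightarrow> 'p padic_int" where
  "Gamma_den g a b =
     padic_Gamma (1 - a) * padic_Gamma (1 - b) * padic_Gamma (1 - g) * padic_Gamma (1 + a + b - g)"

lemma Gamma_num_commute: "Gamma_num g a b = Gamma_num g b a"
  by (simp add: Gamma_num_def mult_ac algebra_simps)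

lemma Gamma_den_commute: "Gamma_den g a b = Gamma_den g b a"
  by (simp add: Gamma_den_def mult_ac add_ac)

lemma pochhammer_reflect: "pochhammer (1 - x - of_nat n) n = (- 1) ^ n * pochhammer (x :: 'a::comm_ring_1) n"
  using pochhammer_minus'[of "- x" n] by (simp add: algebra_simps)

lemma p_not_dvd_one_diff_add:
  fixes x :: "'p::prime_card padic_int"
  assumes "of_nat CARD('p) dvd x + of_int a" "0 < a + int i + 1" "a + int i + 1 < int CARD('p)"
  shows "\<not> of_nat CARD('p) dvd 1 - x + of_nat i"
proof
  assume "of_nat CARD('p) dvd 1 - x + of_nat i"
  hence "of_nat CARD('p) dvd (1 - x + of_nat i) + (x + of_int a)"
    using assms(1) by (rule dvd_add)
  also have "\<dots> = of_int (a + int i + 1)" by simp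
  finally have "int CARD('p) dvd a + int i + 1" by (simp only: of_int_p_dvd_iff)
  from zdvd_imp_le[OF this] show False using assms by simp
qed

text \<open>Numerator and denominator contain Gamma values whose arguments differ by
  \<open>n\<close>, and the functional equation turns each such pair into a Pochhammer symbol. The
  condition \<open>int n + j < c\<close>, with \<open>c\<close> below p, keeps the shifts off the
  multiples of p. The value -1 at 1 makes the two summands cancel.\<close>

lemma Gamma_num_den_eval:
  fixes b g :: "'p::prime_card padic_int"
  assumes odd: "odd CARD('p)"
    and b: "of_nat CARD('p) dvd b + of_int j" "0 \<le> j"
    and g: "of_nat CARD('p) dvd g + of_int c" "c < int CARD('p)"
    and less: "int n + j < c"
  shows "Gamma_num g (- of_nat n) b * (fact n * pochhammer g n) +
         Gamma_den g (- of_nat n) b * (pochhammer (1 - b) n * pochhammer (g - b) n) = 0"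
proof -
  have "(g + of_int c) - (b + of_int j) = g - b + of_int (c - j)"
    by (simp add: algebra_simps)
  with dvd_diff[OF g(1) b(1)] have gb: "of_nat CARD('p) dvd g - b + of_int (c - j)" by (simp only:)
  have ga: "of_nat CARD('p) dvd g + of_nat n + of_int (c - int n)" using g(1) by simp
  have gba: "of_nat CARD('p) dvd g - b + of_nat n + of_int (c - j - int n)"
    using gb by (simp add: algebra_simps)
  have 1: "padic_Gamma (1 - b + of_nat n) = (- 1) ^ n * pochhammer (1 - b) n * padic_Gamma (1 - b)"
    using b less g by (intro padic_Gamma_add_nat[OF odd] p_not_dvd_one_diff_add[OF b(1)]) auto
  \<comment> \<open>The shift starts at \<open>1 - g - n\<close> and ends at \<open>1 - g\<close>;
    \<open>pochhammer_reflect\<close> later converts its symbol into \<open>(g)_n\<close>. The next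
    shift treats \<open>g - b\<close> in the same way.\<close>
  have 2: "padic_Gamma (1 - (g + of_nat n) + of_nat n) =
             (- 1) ^ n * pochhammer (1 - (g + of_nat n)) n * padic_Gamma (1 - (g + of_nat n))"
    using b less g by (intro padic_Gamma_add_nat[OF odd] p_not_dvd_one_diff_add[OF ga]) auto
  have 3: "padic_Gamma (1 - (g - b + of_nat n) + of_nat n) =
             (- 1) ^ n * pochhammer (1 - (g - b + of_nat n)) n * padic_Gamma (1 - (g - b + of_nat n))"
    using b less g by (intro padic_Gamma_add_nat[OF odd] p_not_dvd_one_diff_add[OF gba]) auto
  have "of_nat CARD('p) dvd (0 :: 'p padic_int) + of_int 0" by simp
  hence "padic_Gamma (1 - 0 + of_nat n :: 'p padic_int) =
         (- 1) ^ n * pochhammer (1 - 0) n * padic_Gamma (1 - 0)"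
    using b less g by (intro padic_Gamma_add_nat[OF odd] p_not_dvd_one_diff_add[of 0 0]) auto
  moreover have "padic_Gamma (1 :: 'p padic_int) = - 1"
    using padic_Gamma_plus1[OF odd, of 0] padic_Gamma_0[OF odd] by simp
  ultimately have 4: "padic_Gamma (1 + of_nat n :: 'p padic_int) = - ((- 1) ^ n * fact n)"
    by (simp add: pochhammer_fact)
  have 5: "padic_Gamma (1 - g) = pochhammer g n * padic_Gamma (1 - g - of_nat n)"
    using 2 pochhammer_reflect[of g n] by (simp add: algebra_simps flip: power_add)
  have 6: "padic_Gamma (1 + b - g) = pochhammer (g - b) n * padic_Gamma (1 + b - g - of_nat n)"
    using 3 pochhammer_reflect[of "g - b" n] by (simp add: algebra_simps flip: power_add)
  have num: "Gamma_num g (- of_nat n) b = padic_Gamma (1 - g - of_nat n) * padic_Gamma (1 + b - g) *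
               padic_Gamma (1 - b + of_nat n)"
    by (simp add: Gamma_num_def algebra_simps)
  have den: "Gamma_den g (- of_nat n) b = padic_Gamma (1 + of_nat n) * padic_Gamma (1 - b) *
               padic_Gamma (1 - g) * padic_Gamma (1 + b - g - of_nat n)"
    by (simp add: Gamma_den_def algebra_simps)
  show ?thesis unfolding num den 1 4 5 6 by (simp add: algebra_simps)
qed

section \<open>Both sides as affine functions, and their values on the axes\<close>

lemma affine_mod_p2_saal_sum:
  fixes f h :: "'p::prime_card padic_int \<Rightarrow> 'p padic_int \<Rightarrow> 'p padic_int"
  assumes "\<And>x y. f x y = u + of_nat CARD('p) * x" and "\<And>x y. h x y = v + of_nat CARD('p) * y"
  shows "affine_mod_p2 (\<lambda>x y. saal_sum I c g (f x y) (h x y))"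
  unfolding saal_sum_def
proof (intro affine_mod_p2_sum affine_mod_p2_mult affine_mod_p2_pochhammer affine_mod_p2_const)
  show "affine_mod_p2 f"
    using assms by (intro affine_mod_p2_linear[of _ u 1 0]) simp
  show "affine_mod_p2 h"
    using assms by (intro affine_mod_p2_linear[of _ v 0 1]) simp
  show "affine_mod_p2 (\<lambda>x y. g - f x y - h x y)"
    using assms by (intro affine_mod_p2_linear[of _ "g - u - v" "- 1" "- 1"]) (simp add: algebra_simps)
qed

lemma affine_mod_p2_Gamma_num:
  fixes f h :: "'p::prime_card padic_int \<Rightarrow> 'p padic_int \<Rightarrow> 'p padic_int"
  assumes odd: "odd CARD('p)"
    and f: "\<And>x y. f x y = u + of_nat CARD('p) * x" and h: "\<And>x y. h x y = v + of_nat CARD('p) * y"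
  shows "affine_mod_p2 (\<lambda>x y. Gamma_num g (f x y) (h x y))"
  unfolding Gamma_num_def
proof (intro affine_mod_p2_mult)
  show "affine_mod_p2 (\<lambda>x y. padic_Gamma (1 + f x y - g))"
    by (rule affine_mod_p2_padic_Gamma[OF odd, of _ "1 + u - g" 1 0]) (simp add: f algebra_simps)
  show "affine_mod_p2 (\<lambda>x y. padic_Gamma (1 + h x y - g))"
    by (rule affine_mod_p2_padic_Gamma[OF odd, of _ "1 + v - g" 0 1]) (simp add: h algebra_simps)
  show "affine_mod_p2 (\<lambda>x y. padic_Gamma (1 - f x y - h x y))"
    by (rule affine_mod_p2_padic_Gamma[OF odd, of _ "1 - u - v" "- 1" "- 1"])
       (simp add: f h algebra_simps)
qed

lemma affine_mod_p2_Gamma_den: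
  fixes f h :: "'p::prime_card padic_int \<Rightarrow> 'p padic_int \<Rightarrow> 'p padic_int"
  assumes odd: "odd CARD('p)"
    and f: "\<And>x y. f x y = u + of_nat CARD('p) * x" and h: "\<And>x y. h x y = v + of_nat CARD('p) * y"
  shows "affine_mod_p2 (\<lambda>x y. Gamma_den g (f x y) (h x y))"
  unfolding Gamma_den_def
proof (intro affine_mod_p2_mult affine_mod_p2_const)
  show "affine_mod_p2 (\<lambda>x y. padic_Gamma (1 - f x y))"
    by (rule affine_mod_p2_padic_Gamma[OF odd, of _ "1 - u" "- 1" 0]) (simp add: f algebra_simps)
  show "affine_mod_p2 (\<lambda>x y. padic_Gamma (1 - h x y))"
    by (rule affine_mod_p2_padic_Gamma[OF odd, of _ "1 - v" 0 "- 1"]) (simp add: h algebra_simps)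
  show "affine_mod_p2 (\<lambda>x y. padic_Gamma (1 + f x y + h x y - g))"
    by (rule affine_mod_p2_padic_Gamma[OF odd, of _ "1 + u + v - g" 1 1])
       (simp add: f h algebra_simps)
qed

lemma p_not_dvd_Gamma_den:
  fixes a b g :: "'p::prime_card padic_int"
  assumes "odd CARD('p)"
  shows "\<not> of_nat CARD('p) dvd Gamma_den g a b"
  unfolding Gamma_den_def prime_elem_dvd_mult_iff[OF prime_elem_p]
  using p_not_dvd_padic_Gamma[OF assms] by blast

text \<open>Where the series terminates the identity is exact. Multiplied by
  \<open>fact n * pochhammer g n\<close>, which is not 0, it becomes \<open>saal_sum_eval\<close>
  combined with \<open>Gamma_num_den_eval\<close>.\<close>

lemma saal_sum_Gamma_boundary:
  fixes b g :: "'p::prime_card padic_int"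
  assumes odd: "odd CARD('p)"
    and I: "\<forall>k\<le>c. I k * (fact k ^ 2 * pochhammer g k) = 1"
    and b: "of_nat CARD('p) dvd b + of_nat j"
    and g: "of_nat CARD('p) dvd g + of_nat c" "c < CARD('p)"
    and less: "n + j < c"
  shows "saal_sum I c g (- of_nat n) b * Gamma_den g (- of_nat n) b + Gamma_num g (- of_nat n) b = 0"
proof -
  have n: "n \<le> c" using less by simp
  have "pochhammer g n \<noteq> 0" using I[rule_format, OF n] by auto
  moreover have "(saal_sum I c g (- of_nat n) b * Gamma_den g (- of_nat n) b +
                    Gamma_num g (- of_nat n) b) * (fact n * pochhammer g n) =
     Gamma_num g (- of_nat n) b * (fact n * pochhammer g n) +
       Gamma_den g (- of_nat n) b * (saal_sum I c g (- of_nat n) b * (fact n * pochhammer g n))"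
    by (simp add: algebra_simps)
  moreover have "\<dots> = 0"
    unfolding saal_sum_eval[OF I n] using assms
    by (intro Gamma_num_den_eval[OF odd, of _ "int j" _ "int c"]) auto
  ultimately show ?thesis by simp
qed

text \<open>In the closed form each of \<open>(1 - b)_n\<close> and \<open>(g - b)_n\<close>
  contains a factor divisible by p, because \<open>n + j > p > c\<close>.\<close>

lemma saal_sum_zero_boundary:
  fixes b g :: "'p::prime_card padic_int"
  assumes I: "\<forall>k\<le>c. I k * (fact k ^ 2 * pochhammer g k) = 1"
    and b: "of_nat CARD('p) dvd b + of_nat j" "j \<le> c"
    and g: "of_nat CARD('p) dvd g + of_nat c" "c < CARD('p)"
    and gt: "n + j > CARD('p)" and n: "n \<le> c"
  shows "of_nat CARD('p) ^ 2 dvd saal_sum I c g (- of_nat n) b"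
proof -
  let ?p = "of_nat CARD('p) :: 'p padic_int"
  \<comment> \<open>This is the factor \<open>1 - b + i\<close> with \<open>i = p - j - 1\<close>,
    which is below \<open>n\<close>.\<close>
  have "?p dvd ?p - (b + of_nat j)" using b(1) by (intro dvd_diff) simp_all
  hence "?p dvd pochhammer (1 - b) n"
    using b(2) g gt n by (intro p_dvd_pochhammer[of _ "int CARD('p) - int j - 1"]) (auto simp: algebra_simps)
  moreover have "?p dvd pochhammer (g - b) n"
    using dvd_diff[OF g(1) b(1)] b(2) g gt n
    by (intro p_dvd_pochhammer[of _ "int c - int j"]) (auto simp: add_diff_add diff_add_eq)
  ultimately have "?p ^ 2 dvd saal_sum I c g (- of_nat n) b * (fact n * pochhammer g n)"
    unfolding saal_sum_eval[OF I n] power2_eq_square by (rule mult_dvd_mono)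
  \<comment> \<open>Multiplying by \<open>fact n * I n\<close> undoes the clearing of
    denominators.\<close>
  hence "?p ^ 2 dvd saal_sum I c g (- of_nat n) b * (fact n * pochhammer g n) * (fact n * I n)"
    by (rule dvd_mult2)
  also have "\<dots> = saal_sum I c g (- of_nat n) b * (I n * (fact n ^ 2 * pochhammer g n))"
    by (simp add: power2_eq_square mult_ac)
  finally show ?thesis using I[rule_format, OF n] by simp
qed

section \<open>The two congruences\<close>

theorem theorem2p11:
  fixes p :: nat and \<alpha> \<beta> \<gamma> :: "'p::prime_card padic_int"
  assumes "p = CARD('p)" and "prime p" and "odd p"
    and "max (least_residue (- \<alpha>)) (least_residue (- \<beta>)) \<le> least_residue (- \<gamma>)"
    and "\<not> of_nat p ^ 2 dvd pochhammer \<gamma> (p - 1)"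
  shows "(least_residue (- \<alpha>) + least_residue (- \<beta>) < least_residue (- \<gamma>) \<longrightarrow>
           padic_cong 2
             (trunc_hypergeom [to_fract \<alpha>, to_fract \<beta>, to_fract (\<gamma> - \<alpha> - \<beta>)]
                [1, to_fract \<gamma>] 1 (p - 1))
             (- ((to_fract (padic_Gamma (1 + \<alpha> - \<gamma>)) * to_fract (padic_Gamma (1 + \<beta> - \<gamma>))
                   * to_fract (padic_Gamma (1 - \<alpha> - \<beta>))) /
                 (to_fract (padic_Gamma (1 - \<alpha>)) * to_fract (padic_Gamma (1 - \<beta>))
                   * to_fract (padic_Gamma (1 - \<gamma>)) * to_fract (padic_Gamma (1 + \<alpha> + \<beta> - \<gamma>)))))) \<and>
         (least_residue (- \<alpha>) + least_residue (- \<beta>) > int p \<longrightarrow>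
           padic_cong 2
             (trunc_hypergeom [to_fract \<alpha>, to_fract \<beta>, to_fract (\<gamma> - \<alpha> - \<beta>)]
                [1, to_fract \<gamma>] 1 (p - 1))
             0)"
proof -
  let ?p = "of_nat CARD('p) :: 'p padic_int"
  let ?S = "trunc_hypergeom [to_fract \<alpha>, to_fract \<beta>, to_fract (\<gamma> - \<alpha> - \<beta>)] [1, to_fract \<gamma>] 1 (p - 1)"
  have odd: "odd CARD('p)" using assms by simp
  have residue: "\<exists>n. least_residue (- x) = int n \<and> n < CARD('p) \<and> ?p dvd x + of_nat n"
    for x :: "'p padic_int"
  proof -
    define n where "n = nat (padic_res (- x) 1)"
    have n: "padic_res (- x) 1 = int n" and "n < CARD('p)"
      using padic_res_bounds[of "- x" 1] by (simp_all add: n_def nat_less_iff)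
    moreover have "?p dvd - x - of_nat n"
      unfolding p_dvd_diff_iff padic_res_of_nat n using \<open>n < CARD('p)\<close> by simp
    hence "?p dvd - (x + of_nat n)" by simp
    ultimately show ?thesis by (auto simp: least_residue_eq simp del: minus_add_distrib)
  qed
  obtain a where a: "least_residue (- \<alpha>) = int a" "a < CARD('p)" "?p dvd \<alpha> + of_nat a"
    using residue by blast
  obtain b where b: "least_residue (- \<beta>) = int b" "b < CARD('p)" "?p dvd \<beta> + of_nat b"
    using residue by blast
  obtain c where c: "least_residue (- \<gamma>) = int c" "c < CARD('p)" "?p dvd \<gamma> + of_nat c"
    using residue by blast
  have ac: "a \<le> c" and bc: "b \<le> c" using assms(4) a b c by auto
  obtain x where x: "\<alpha> = - of_nat a + ?p * x"
    using a(3) by (metis dvdE add.commute minus_add_cancel)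
  obtain y where y: "\<beta> = - of_nat b + ?p * y"
    using b(3) by (metis dvdE add.commute minus_add_cancel)

  \<comment> \<open>For \<open>i < k \<le> c\<close> the factor \<open>\<gamma> + i\<close> is
    congruent to \<open>i - c\<close>, which is not 0 modulo p; moreover
    \<open>k < p\<close>.\<close>
  have "\<exists>z. z * (fact k ^ 2 * pochhammer \<gamma> k) = 1" if "k \<le> c" for k
  proof -
    have "\<not> ?p dvd fact k" using that c by (intro p_not_dvd_fact) simp
    moreover have "\<not> ?p dvd pochhammer \<gamma> k"
      using that c by (intro p_not_dvd_pochhammer[of _ "int c"]) auto
    ultimately have "\<not> ?p dvd fact k ^ 2 * pochhammer \<gamma> k"
      by (auto simp: power2_eq_square prime_elem_dvd_mult_iff[OF prime_elem_p])
    thus ?thesis by (metis padic_unit mult.commute)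
  qed
  then obtain I where I: "\<forall>k\<le>c. I k * (fact k ^ 2 * pochhammer \<gamma> k) = 1" by metis

  \<comment> \<open>\<open>A\<close> and \<open>B\<close> run through the residue classes of
    \<alpha> and \<beta>. At 0 they are non-positive integers, where the series terminates; at
    \<open>x\<close> and \<open>y\<close> they are the given parameters.\<close>
  define A B where "A x = - of_nat a + ?p * x" and "B y = - of_nat b + ?p * y" for x y :: "'p padic_int"
  have A: "?p dvd A t + of_nat a" and B: "?p dvd B t + of_nat b" for t
    by (simp_all add: A_def B_def)
  have A0: "A 0 = - of_nat a" and B0: "B 0 = - of_nat b" by (simp_all add: A_def B_def)
  have Ax: "A x = \<alpha>" and By: "B y = \<beta>" by (simp_all add: A_def B_def x y)
  have \<gamma>\<alpha>\<beta>: "?p dvd \<gamma> - \<alpha> - \<beta> + of_int (int c - int a - int b)"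
  proof -
    have "?p dvd (\<gamma> + of_nat c) - (\<alpha> + of_nat a) - (\<beta> + of_nat b)"
      using a b c by (intro dvd_diff)
    also have "\<dots> = \<gamma> - \<alpha> - \<beta> + of_int (int c - int a - int b)" by simp
    finally show ?thesis .
  qed
  \<comment> \<open>\<open>d\<close> stays free because the representative of
    \<open>c - a - b\<close> modulo p lying between 0 and \<open>c\<close> differs in the two
    cases.\<close>
  have S: "\<exists>z. ?S = to_fract (saal_sum I c \<gamma> \<alpha> \<beta> + ?p ^ 2 * z)"
    if d: "?p dvd \<gamma> - \<alpha> - \<beta> + of_int d" "0 \<le> d" "d \<le> int c" for d
  proof -
    have "?p dvd \<alpha> + of_int (int a)" "?p dvd \<beta> + of_int (int b)" using a b by simp_all
    moreover have "\<not> ?p ^ 2 dvd pochhammer \<gamma> (CARD('p) - 1)" using assms(1,5) by simp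
    ultimately show ?thesis
      unfolding assms(1) using d ac bc c(2) I
      by (elim trunc_hypergeom_eq_saal_sum[of \<alpha> "int a" c \<beta> "int b" \<gamma> d I]) auto
  qed

  show ?thesis
  proof (intro conjI impI)
    assume less: "least_residue (- \<alpha>) + least_residue (- \<beta>) < least_residue (- \<gamma>)"
    hence abc: "a + b < c" using a b c by simp
    \<comment> \<open>The claimed congruence, cleared of the denominator; it is to be shown that
      \<open>H\<close> vanishes modulo \<open>p ^ 2\<close>.\<close>
    define H where "H x y = saal_sum I c \<gamma> (A x) (B y) * Gamma_den \<gamma> (A x) (B y)
                              + Gamma_num \<gamma> (A x) (B y)" for x y
    have "affine_mod_p2 (\<lambda>x y. H x y)"
      unfolding H_def
      by (intro affine_mod_p2_add affine_mod_p2_mult affine_mod_p2_saal_sum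
          affine_mod_p2_Gamma_den[OF odd] affine_mod_p2_Gamma_num[OF odd])
         (simp_all only: A_def B_def)
    moreover have "H 0 t = 0" for t
      unfolding H_def A0 by (rule saal_sum_Gamma_boundary[OF odd I B c(3,2) abc])
    \<comment> \<open>All three functions are symmetric in the two parameters, so the second axis
      reduces to the first.\<close>
    moreover have "H t 0 = 0" for t
      unfolding H_def B0 saal_sum_commute[of _ _ _ "A t"] Gamma_den_commute[of _ "A t"]
        Gamma_num_commute[of _ "A t"]
      using abc by (intro saal_sum_Gamma_boundary[OF odd I A c(3,2)]) simp
    ultimately have "?p ^ 2 dvd H x y"
      by (elim affine_mod_p2_vanish) simp_all
    then obtain h where h: "saal_sum I c \<gamma> \<alpha> \<beta> * Gamma_den \<gamma> \<alpha> \<beta> + Gamma_num \<gamma> \<alpha> \<beta> = ?p ^ 2 * h"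
      unfolding H_def Ax By by blast
    obtain e where e: "Gamma_den \<gamma> \<alpha> \<beta> * e = 1"
      using padic_unit[OF p_not_dvd_Gamma_den[OF odd]] by metis
    obtain z where z: "?S = to_fract (saal_sum I c \<gamma> \<alpha> \<beta> + ?p ^ 2 * z)"
      using S[OF \<gamma>\<alpha>\<beta>] abc by auto
    have "to_fract (Gamma_num \<gamma> \<alpha> \<beta>) / to_fract (Gamma_den \<gamma> \<alpha> \<beta>) = to_fract (Gamma_num \<gamma> \<alpha> \<beta> * e)"
    proof -
      have "to_fract (Gamma_den \<gamma> \<alpha> \<beta>) * to_fract e = 1"
        using arg_cong[OF e, of to_fract] by simp
      moreover from this have "to_fract (Gamma_den \<gamma> \<alpha> \<beta>) \<noteq> 0" by (metis mult_zero_left zero_neq_one)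
      ultimately show ?thesis
        by (simp only: to_fract_mult divide_eq_eq if_False mult.assoc mult.commute[of "to_fract e"]) simp
    qed
    moreover have "saal_sum I c \<gamma> \<alpha> \<beta> + ?p ^ 2 * z + Gamma_num \<gamma> \<alpha> \<beta> * e = ?p ^ 2 * (h * e + z)"
    proof -
      have "saal_sum I c \<gamma> \<alpha> \<beta> + Gamma_num \<gamma> \<alpha> \<beta> * e =
              (saal_sum I c \<gamma> \<alpha> \<beta> * Gamma_den \<gamma> \<alpha> \<beta> + Gamma_num \<gamma> \<alpha> \<beta>) * e"
        by (simp add: distrib_right mult.assoc e)
      thus ?thesis unfolding h by (simp add: algebra_simps)
    qed
    ultimately have "?S + to_fract (Gamma_num \<gamma> \<alpha> \<beta>) / to_fract (Gamma_den \<gamma> \<alpha> \<beta>) =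
                       to_fract (?p ^ 2 * (h * e + z))"
      unfolding z by (simp only: to_fract_add[symmetric])
    hence "padic_cong 2 ?S (- (to_fract (Gamma_num \<gamma> \<alpha> \<beta>) / to_fract (Gamma_den \<gamma> \<alpha> \<beta>)))"
      unfolding padic_cong_def by (intro exI[of _ "h * e + z"]) simp
    thus "padic_cong 2 ?S
             (- ((to_fract (padic_Gamma (1 + \<alpha> - \<gamma>)) * to_fract (padic_Gamma (1 + \<beta> - \<gamma>))
                   * to_fract (padic_Gamma (1 - \<alpha> - \<beta>))) /
                 (to_fract (padic_Gamma (1 - \<alpha>)) * to_fract (padic_Gamma (1 - \<beta>))
                   * to_fract (padic_Gamma (1 - \<gamma>)) * to_fract (padic_Gamma (1 + \<alpha> + \<beta> - \<gamma>)))))"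
      by (simp only: Gamma_num_def Gamma_den_def to_fract_mult)
  next
    assume "least_residue (- \<alpha>) + least_residue (- \<beta>) > int p"
    hence ab: "a + b > CARD('p)" using a b assms(1) by simp
    hence ba: "b + a > CARD('p)" by simp
    have affine: "affine_mod_p2 (\<lambda>x y. saal_sum I c \<gamma> (A x) (B y))"
      by (intro affine_mod_p2_saal_sum) (simp_all only: A_def B_def)
    have zero1: "?p ^ 2 dvd saal_sum I c \<gamma> (A 0) (B t)" for t
      unfolding A0 by (rule saal_sum_zero_boundary[OF I B bc c(3,2) ab ac])
    have zero2: "?p ^ 2 dvd saal_sum I c \<gamma> (A t) (B 0)" for t
      unfolding B0 saal_sum_commute[of _ _ _ "A t"]
      by (rule saal_sum_zero_boundary[OF I A ac c(3,2) ba bc])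
    have "?p ^ 2 dvd saal_sum I c \<gamma> (A x) (B y)"
      by (rule affine_mod_p2_vanish[OF affine zero2 zero1])
    then obtain h where h: "saal_sum I c \<gamma> \<alpha> \<beta> = ?p ^ 2 * h"
      unfolding Ax By by blast
    \<comment> \<open>Here \<open>c - a - b\<close> is negative. Adding p gives a representative
      that is at least 0, as \<open>b \<le> c\<close> and \<open>a < p\<close>, and at most
      \<open>c\<close>, as \<open>a + b > p\<close>.\<close>
    have "?p dvd (\<gamma> - \<alpha> - \<beta> + of_int (int c - int a - int b)) + ?p"
      using \<gamma>\<alpha>\<beta> by (rule dvd_add) simp
    also have "\<dots> = \<gamma> - \<alpha> - \<beta> + of_int (int c - int a - int b + int CARD('p))" by simp
    finally obtain z where "?S = to_fract (saal_sum I c \<gamma> \<alpha> \<beta> + ?p ^ 2 * z)"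
      using S[of "int c - int a - int b + int CARD('p)"] a(2) ab ac bc by auto
    hence "?S = to_fract (?p ^ 2 * (h + z))"
      by (simp only: h distrib_left)
    thus "padic_cong 2 ?S 0"
      unfolding padic_cong_def by (intro exI[of _ "h + z"]) simp
  qed
qed

end
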